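(* Suppose that $\boldsymbol{B}^{(p)}\boldsymbol{\Sigma}_2$ has full column rank. Let $\{\boldsymbol{\beta}_t\}_{t\ge0}\subset\mathbb{R}^{l-1}$ be a sequence generated by the GIST algorithm (described in the context, run without stopping) applied to minimizing $$F(\boldsymbol{\beta})=\tfrac{1}{2}\|\boldsymbol{z}_1-\boldsymbol{L}_1\boldsymbol{\beta}\|_2^2+\tfrac{c}{2}\|\boldsymbol{z}_2-\boldsymbol{L}_2\boldsymbol{\beta}\|_2^2+\gamma T_K(\boldsymbol{\beta})$$ over $\boldsymbol{\beta}\in\mathbb{R}^{l-1}$. Then any accumulation point of $\{\boldsymbol{\beta}_t\}$ is a local minimum of $F$, and any accumulation point of $\left\{\boldsymbol{\Sigma}^{(p+1)}\begin{pmatrix}\boldsymbol{\beta}_t\\ g(\boldsymbol{\beta}_t)\end{pmatrix}\right\}$ is a local minimum over $\boldsymbol{\alpha}\in\mathbb{R}^{l+p}$ of $$\tfrac12\|\boldsymbol{y}-\boldsymbol{B}^{(p)}\boldsymbol{\alpha}\|_2^2+\tfrac{c}{2}\|\boldsymbol{D}\boldsymbol{\alpha}\|_2^2+\gamma T_K(\boldsymbol{D}^{(p+1)}\boldsymbol{\alpha}).$$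
   Context: Setting. Let $p\ge0$, $l\ge2$, $n\ge1$ be integers, $t_{-p}<t_{-p+1}<\cdots<t_{l+p}$ real knots, $(x_i,y_i)\in\mathbb{R}^2$, $i=1,\dots,n$, data with $x_i\in[t_0,t_l)$, $\boldsymbol{y}=(y_1,\dots,y_n)^\top$, $c\ge0$, $\gamma>0$, and $K\in\{0,\dots,l-1\}$. B-spline basis functions: $B^{(0)}_j(x)=1$ if $t_j\le x<t_{j+1}$ and $0$ otherwise, $j=-p,\dots,l+p-1$; for $q=1,\dots,p$ and $j=-p,\dots,l+p-q-1$, $$B^{(q)}_{j}(x)=\frac{x-t_{j}}{t_{j+q}-t_{j}}B^{(q-1)}_{j}(x)+\frac{t_{j+q+1}-x}{t_{j+q+1}-t_{j+1}}B^{(q-1)}_{j+1}(x).$$ $\boldsymbol{B}^{(p)}$ is the $n\times(l+p)$ matrix whose $i$-th row is $(B^{(p)}_{-p}(x_i),\dots,B^{(p)}_{l-1}(x_i))$. $\boldsymbol{D}$ is a fixed (ordinary) difference matrix with $l+p$ columns, of arbitrary order $m$ with $1\le m\le l+p-1$: $\boldsymbol{D}\boldsymbol{\alpha}$ is the vector of $m$-th order differences of consecutive entries of $\boldsymbol{\alpha}$. Scaled difference matrices: $\boldsymbol{D}^{(1)}\in\mathbb{R}^{(l-1)\times l}$ has $(i,i)$ entry $-1$, $(i,i+1)$ entry $1$, other entries $0$. For $1\le q\le p$, $\boldsymbol{\Delta}^{(q+1)}\in\mathbb{R}^{(l-1+q)\times(l+q)}$ has $r$-th row with entry $-\frac{1}{t_r-t_{r-q}}$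 in column $r$, entry $\frac{1}{t_r-t_{r-q}}$ in column $r+1$, zeros elsewhere; $\boldsymbol{D}^{(q+1)}=\boldsymbol{D}^{(q)}\boldsymbol{\Delta}^{(q+1)}$. The matrix $\boldsymbol{D}^{(p+1)}\in\mathbb{R}^{(l-1)\times(l+p)}$ has rank $l-1$. Change of variables: $\boldsymbol{A}\in\mathbb{R}^{(p+1)\times(l+p)}$ is a fixed matrix such that $\hat{\boldsymbol{D}}^{(p+1)}=\begin{pmatrix}\boldsymbol{D}^{(p+1)}\\ \boldsymbol{A}\end{pmatrix}\in\mathbb{R}^{(l+p)\times(l+p)}$ is nonsingular; $\boldsymbol{\Sigma}^{(p+1)}=(\hat{\boldsymbol{D}}^{(p+1)})^{-1}=(\boldsymbol{\Sigma}_1\ \boldsymbol{\Sigma}_2)$ with $\boldsymbol{\Sigma}_1\in\mathbb{R}^{(l+p)\times(l-1)}$, $\boldsymbol{\Sigma}_2\in\mathbb{R}^{(l+p)\times(p+1)}$. When $\boldsymbol{B}^{(p)}\boldsymbol{\Sigma}_2$ has full column rank, put $\boldsymbol{M}=(\boldsymbol{B}^{(p)}\boldsymbol{\Sigma}_2)^\top\boldsymbol{B}^{(p)}\boldsymbol{\Sigma}_2+c(\boldsymbol{D}\boldsymbol{\Sigma}_2)^\top\boldsymbol{D}\boldsymbol{\Sigma}_2$ (invertible), and $$\boldsymbol{H}_1=\boldsymbol{M}^{-1}(\boldsymbol{B}^{(p)}\boldsymbol{\Sigma}_2)^\top,\qquad \boldsymbol{H}_2=\boldsymbol{M}^{-1}\{(\boldsymbol{B}^{(p)}\boldsymbol{\Sigma}_2)^\top\boldsymbol{B}^{(p)}\boldsymbol{\Sigma}_1+c(\boldsymbol{D}\boldsymbol{\Sigma}_2)^\top\boldsymbol{D}\boldsymbol{\Sigma}_1\},$$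 $$\boldsymbol{z}_1=\boldsymbol{y}-\boldsymbol{B}^{(p)}\boldsymbol{\Sigma}_2\boldsymbol{H}_1\boldsymbol{y},\quad \boldsymbol{z}_2=\boldsymbol{D}\boldsymbol{\Sigma}_2\boldsymbol{H}_1\boldsymbol{y},\quad \boldsymbol{L}_1=\boldsymbol{B}^{(p)}\boldsymbol{\Sigma}_1-\boldsymbol{B}^{(p)}\boldsymbol{\Sigma}_2\boldsymbol{H}_2,\quad \boldsymbol{L}_2=\boldsymbol{D}\boldsymbol{\Sigma}_2\boldsymbol{H}_2-\boldsymbol{D}\boldsymbol{\Sigma}_1,$$ and $g(\boldsymbol{\beta})=\boldsymbol{H}_1\boldsymbol{y}-\boldsymbol{H}_2\boldsymbol{\beta}\in\mathbb{R}^{p+1}$. For $\boldsymbol{z}\in\mathbb{R}^d$ with entries ordered so that $|z_{(1)}|\ge\cdots\ge|z_{(d)}|$, $T_K(\boldsymbol{z})=|z_{(K+1)}|+\cdots+|z_{(d)}|$ (sum of the $d-K$ smallest absolute values); here $d=l-1$. For a function $\phi$ on $\mathbb{R}^d$, $\mathrm{prox}_\phi(\boldsymbol{a})=\operatorname{argmin}_{\boldsymbol{z}}\{\phi(\boldsymbol{z})+\frac12\|\boldsymbol{z}-\boldsymbol{a}\|_2^2\}$ (a set). GIST algorithm. Let $h(\boldsymbol{\beta})=\frac12\|\boldsymbol{z}_1-\boldsymbol{L}_1\boldsymbol{\beta}\|_2^2+\frac c2\|\boldsymbol{z}_2-\boldsymbol{L}_2\boldsymbol{\beta}\|_2^2$,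 so $F=h+\gamma T_K$. Parameters: $\rho>1$, $0<\underline\eta\le\overline\eta$, $\sigma\in(0,1)$, an integer $M\ge1$. Initialize with arbitrary $\boldsymbol{\beta}_0\in\mathbb{R}^{l-1}$ and $\eta_0\in[\underline\eta/\rho,\overline\eta/\rho]$. For $t=0,1,2,\dots$: (1) Repeat: replace $\eta_t$ by $\rho\eta_t$ and choose any $\boldsymbol{\beta}_{t+1}\in\mathrm{prox}_{\gamma T_K/\eta_t}\left(\boldsymbol{\beta}_t-\frac{1}{\eta_t}\nabla h(\boldsymbol{\beta}_t)\right)$; until $$F(\boldsymbol{\beta}_{t+1})\le\max_{\max\{t-M+1,0\}\le s\le t}F(\boldsymbol{\beta}_s)-\frac{\sigma\eta_t}{2}\|\boldsymbol{\beta}_{t+1}-\boldsymbol{\beta}_t\|_2^2.$$ (2) Set $$\eta_{t+1}=\frac1\rho\min\left\{\overline\eta,\max\left\{\underline\eta,\frac{(\nabla h(\boldsymbol{\beta}_{t+1})-\nabla h(\boldsymbol{\beta}_t))^\top(\boldsymbol{\beta}_{t+1}-\boldsymbol{\beta}_t)}{\|\boldsymbol{\beta}_{t+1}-\boldsymbol{\beta}_t\|_2^2}\right\}\right\},$$ where, if $\boldsymbol{\beta}_{t+1}=\boldsymbol{\beta}_t$, the quotient may be given any real value. *)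

theory Defs
  imports
    Complex_Main
    "Jordan_Normal_Form.DL_Rank"
    "Jordan_Normal_Form.Gauss_Jordan_Elimination"
begin

text \<open>Matrices and vectors are those of Jordan_Normal_Form, so rows, columns and entries
  are counted from 0. Knots and B-splines keep their integer indices; only the knots with index in
  \<open>{-p..l+p}\<close> matter.\<close>

section \<open>Euclidean space, local minima, accumulation points\<close>

definition vnorm :: "real vec \<Rightarrow> real" where
  "vnorm v = sqrt (v \<bullet> v)"

definition is_local_min :: "nat \<Rightarrow> (real vec \<Rightarrow> real) \<Rightarrow> real vec \<Rightarrow> bool" where
  "is_local_min d f a \<longleftrightarrow> a \<in> carrier_vec d \<and>
     (\<exists>\<epsilon>>0. \<forall>w\<in>carrier_vec d. vnorm (w - a) < \<epsilon> \<longrightarrow> f a \<le> f w)"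

text \<open>An accumulation point of a sequence is the limit of one of its subsequences.\<close>

definition is_accumulation_point :: "nat \<Rightarrow> (nat \<Rightarrow> real vec) \<Rightarrow> real vec \<Rightarrow> bool" where
  "is_accumulation_point d X a \<longleftrightarrow> a \<in> carrier_vec d \<and>
     (\<exists>r. strict_mono r \<and> (\<lambda>k. vnorm (X (r k) - a)) \<longlonglongrightarrow> 0)"

text \<open>The vector of partial derivatives; meaningful where these exist.\<close>

definition gradient :: "nat \<Rightarrow> (real vec \<Rightarrow> real) \<Rightarrow> real vec \<Rightarrow> real vec" where
  "gradient d f v = vec d (\<lambda>i.
     THE D. ((\<lambda>s. f (v + s \<cdot>\<^sub>v unit_vec d i)) has_real_derivative D) (at 0))"

section \<open>B-splines and difference matrices\<close>

fun bspline :: "(int \<Rightarrow> real) \<Rightarrow> nat \<Rightarrow> int \<Rightarrow> real \<Rightarrow> real" where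
  "bspline t 0 j x = (if t j \<le> x \<and> x < t (j + 1) then 1 else 0)"
| "bspline t (Suc q) j x =
     (x - t j) / (t (j + int (Suc q)) - t j) * bspline t q j x +
     (t (j + int (Suc q) + 1) - x) / (t (j + int (Suc q) + 1) - t (j + 1)) * bspline t q (j + 1) x"

definition bspline_mat :: "(int \<Rightarrow> real) \<Rightarrow> nat \<Rightarrow> nat \<Rightarrow> real vec \<Rightarrow> real mat" where
  "bspline_mat t l p x =
     mat (dim_vec x) (l + p) (\<lambda>(i, j). bspline t p (int j - int p) (x $ i))"

definition first_diff_mat :: "nat \<Rightarrow> real mat" where
  "first_diff_mat k =
     mat k (k + 1) (\<lambda>(i, j). if j = i then - 1 else if j = i + 1 then 1 else 0)"

text \<open>The (unscaled) \<open>m\<close>-th order difference matrix of size \<open>(N - m) \<times> N\<close>, for \<open>m < N\<close>.\<close>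

fun diff_mat :: "nat \<Rightarrow> nat \<Rightarrow> real mat" where
  "diff_mat N 0 = 1\<^sub>m N"
| "diff_mat N (Suc m) = first_diff_mat (N - Suc m) * diff_mat N m"

text \<open>\<open>Delta_mat t l q\<close> is the matrix usually written \<open>\<Delta>\<close> with superscript \<open>q + 1\<close>, and
  \<open>scaled_diff_mat t l q\<close> is \<open>D\<close> with superscript \<open>q + 1\<close>. The row with 0-based index \<open>i\<close> is the
  row \<open>r = i + 1\<close> in the formula \<open>1 / (t\<^sub>r - t\<^bsub>r-q\<^esub>)\<close>.\<close>

definition Delta_mat :: "(int \<Rightarrow> real) \<Rightarrow> nat \<Rightarrow> nat \<Rightarrow> real mat" where
  "Delta_mat t l q = mat (l - 1 + q) (l + q) (\<lambda>(i, j).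
     let w = 1 / (t (int i + 1) - t (int i + 1 - int q))
     in if j = i then - w else if j = i + 1 then w else 0)"

fun scaled_diff_mat :: "(int \<Rightarrow> real) \<Rightarrow> nat \<Rightarrow> nat \<Rightarrow> real mat" where
  "scaled_diff_mat t l 0 = first_diff_mat (l - 1)"
| "scaled_diff_mat t l (Suc q) = scaled_diff_mat t l q * Delta_mat t l (Suc q)"

definition take_cols :: "nat \<Rightarrow> real mat \<Rightarrow> real mat" where
  "take_cols k A = mat (dim_row A) k (\<lambda>(i, j). A $$ (i, j))"

definition drop_cols :: "nat \<Rightarrow> real mat \<Rightarrow> real mat" where
  "drop_cols k A = mat (dim_row A) (dim_col A - k) (\<lambda>(i, j). A $$ (i, k + j))"

text \<open>The inverse; only meaningful for invertible matrices.\<close>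

definition mat_inv :: "real mat \<Rightarrow> real mat" where
  "mat_inv A = the (mat_inverse A)"

section \<open>The trimmed penalty, proximal maps and the GIST algorithm\<close>

definition trimmed_l1 :: "nat \<Rightarrow> real vec \<Rightarrow> real" where
  "trimmed_l1 K z = sum_list (drop K (rev (sort (map abs (list_of_vec z)))))"

definition prox :: "nat \<Rightarrow> (real vec \<Rightarrow> real) \<Rightarrow> real vec \<Rightarrow> real vec set" where
  "prox d \<phi> a =
     {z. is_arg_min (\<lambda>z. \<phi> z + 1/2 * (vnorm (z - a))\<^sup>2) (\<lambda>z. z \<in> carrier_vec d) z}"

text \<open>\<open>gist_search d h \<phi> \<rho> \<sigma> R b \<eta> w\<close>: the inner loop for the objective \<open>h + \<phi>\<close>, started at iterate
  \<open>b\<close> with step parameter \<open>\<eta>\<close> and reference value \<open>R\<close>, can terminate (for some choice of elements of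
  the proximal sets) with next iterate \<open>w\<close>. Each pass replaces \<open>\<eta>\<close> by \<open>\<rho> * \<eta>\<close> before anything else.\<close>

inductive gist_search ::
  "nat \<Rightarrow> (real vec \<Rightarrow> real) \<Rightarrow> (real vec \<Rightarrow> real) \<Rightarrow> real \<Rightarrow> real \<Rightarrow> real \<Rightarrow> real vec \<Rightarrow>
     real \<Rightarrow> real vec \<Rightarrow> bool"
  for d h \<phi> \<rho> \<sigma> R b
where
  accept: "\<lbrakk>\<eta>' = \<rho> * \<eta>;
      w \<in> prox d (\<lambda>z. \<phi> z / \<eta>') (b - (1 / \<eta>') \<cdot>\<^sub>v gradient d h b);
      h w + \<phi> w \<le> R - \<sigma> * \<eta>' / 2 * (vnorm (w - b))\<^sup>2\<rbrakk>
    \<Longrightarrow> gist_search d h \<phi> \<rho> \<sigma> R b \<eta> w"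
| retry: "\<lbrakk>\<eta>' = \<rho> * \<eta>;
      w' \<in> prox d (\<lambda>z. \<phi> z / \<eta>') (b - (1 / \<eta>') \<cdot>\<^sub>v gradient d h b);
      \<not> h w' + \<phi> w' \<le> R - \<sigma> * \<eta>' / 2 * (vnorm (w' - b))\<^sup>2;
      gist_search d h \<phi> \<rho> \<sigma> R b \<eta>' w\<rbrakk>
    \<Longrightarrow> gist_search d h \<phi> \<rho> \<sigma> R b \<eta> w"

text \<open>\<open>\<eta> k\<close> is the step parameter with which iteration \<open>k\<close> is entered. Truncated subtraction makes
  \<open>{Suc k - mem..k}\<close> the window \<open>max {k - mem + 1, 0} \<le> s \<le> k\<close>. The number \<open>r\<close> is the
  quotient in the step rule, arbitrary when two consecutive iterates coincide.\<close>

definition gist_sequence ::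
  "nat \<Rightarrow> (real vec \<Rightarrow> real) \<Rightarrow> (real vec \<Rightarrow> real) \<Rightarrow> real \<Rightarrow> real \<Rightarrow> real \<Rightarrow> real \<Rightarrow> nat \<Rightarrow>
     (nat \<Rightarrow> real vec) \<Rightarrow> bool"
where
  "gist_sequence d h \<phi> \<rho> \<eta>lo \<eta>hi \<sigma> mem \<beta> \<longleftrightarrow>
     \<beta> 0 \<in> carrier_vec d \<and>
     (\<exists>\<eta>. \<eta> 0 \<in> {\<eta>lo / \<rho>..\<eta>hi / \<rho>} \<and>
       (\<forall>k. gist_search d h \<phi> \<rho> \<sigma> (Max ((\<lambda>s. h (\<beta> s) + \<phi> (\<beta> s)) ` {Suc k - mem..k}))
              (\<beta> k) (\<eta> k) (\<beta> (Suc k)) \<and>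
            (\<exists>r. (\<beta> (Suc k) \<noteq> \<beta> k \<longrightarrow>
                   r = ((gradient d h (\<beta> (Suc k)) - gradient d h (\<beta> k)) \<bullet> (\<beta> (Suc k) - \<beta> k))
                       / (vnorm (\<beta> (Suc k) - \<beta> k))\<^sup>2) \<and>
                 \<eta> (Suc k) = 1 / \<rho> * min \<eta>hi (max \<eta>lo r))))"

end

theory Submission
  imports Defs "HOL-Analysis.L2_Norm"
begin

text \<open>
  The penalty is the minimum of the sums of \<open>|z i|\<close> over all index sets of size \<open>d - K\<close>
  (\<open>trimmed_l1_le\<close>, \<open>trimmed_l1_attained\<close>). Hence \<open>F\<close> is a minimum of finitely many convex functions,
  and for such a function a first-order condition suffices for a local minimum: if
  \<open>F a \<le> F z + E / 2 * |z - a|\<^sup>2\<close> for all \<open>z\<close>, then each convex function that is active at \<open>a\<close> has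
  its global minimum there, and the others do not matter near \<open>a\<close>
  (\<open>quadratic_minorant_finite_min_local_min\<close>).

  Accumulation points of the iteration satisfy this inequality. The smooth part \<open>h\<close> is convex and
  \<open>L\<close>-smooth, so a proximal step from \<open>b\<close> to \<open>w\<close> with parameter \<open>\<eta>\<close> gives
  \<open>F w + (\<eta> - L) / 2 * |w - b|\<^sup>2 \<le> F z + \<eta> / 2 * |z - b|\<^sup>2\<close> for all \<open>z\<close>
  (\<open>prox_step_objective\<close>). With \<open>z = b\<close> this shows that the line search accepts as soon as
  \<open>\<eta> \<ge> L / (1 - \<sigma>)\<close>, so that accepted parameters are bounded (\<open>gist_search_accepts\<close>), and that
  one step increases \<open>F\<close> by at most \<open>L / 2\<close> times its squared length. The latter is what is needed to
  conclude from the nonmonotone acceptance rule that the step lengths tend to 0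
  (\<open>nonmonotone_descent_step_tendsto_0\<close>), even if the iterates are unbounded. Then the displayed
  inequality passes to the limit (\<open>gist_accumulation_point_quadratic_minorant\<close>).

  For the second claim, the invertible change of variables writes \<open>\<alpha>\<close> through \<open>\<beta>\<close>, which is
  \<open>Ds \<alpha>\<close>, and \<open>A \<alpha>\<close>. The penalty depends on \<open>\<beta>\<close> only, and minimizing the remaining least squares
  problem over \<open>A \<alpha>\<close> yields \<open>g \<beta>\<close> and the value \<open>F \<beta>\<close> (\<open>partial_minimization\<close>). So the objective
  in \<open>\<alpha>\<close> lies above \<open>F\<close> of \<open>Ds \<alpha>\<close>, with equality on the closed set where \<open>A \<alpha> = g (Ds \<alpha>)\<close>, which
  contains the given sequence; a local minimum of \<open>F\<close> therefore lifts
  (\<open>is_local_min_transfer\<close>).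
\<close>

section \<open>The Euclidean norm of coordinate vectors\<close>

lemma vnorm_eq_L2_set: "vnorm v = L2_set (($) v) {0..<dim_vec v}"
  by (simp add: vnorm_def L2_set_def scalar_prod_def power2_eq_square)

lemma vnorm_nonneg [simp]: "0 \<le> vnorm v"
  by (simp add: vnorm_eq_L2_set)

lemma vnorm_power2: "(vnorm v)\<^sup>2 = v \<bullet> v"
  by (simp add: vnorm_eq_L2_set L2_set_def scalar_prod_def power2_eq_square sum_nonneg)

lemma vnorm_eq_0_iff:
  assumes "v \<in> carrier_vec d"
  shows "vnorm v = 0 \<longleftrightarrow> v = 0\<^sub>v d"
  using assms by (auto simp: vnorm_eq_L2_set L2_set_eq_0_iff)

lemma vnorm_add_le:
  assumes "v \<in> carrier_vec d" "w \<in> carrier_vec d"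
  shows "vnorm (v + w) \<le> vnorm v + vnorm w"
proof -
  have "vnorm (v + w) = L2_set (\<lambda>i. v $ i + w $ i) {0..<d}"
    unfolding vnorm_eq_L2_set using assms by (intro L2_set_cong) auto
  also have "\<dots> \<le> L2_set (($) v) {0..<d} + L2_set (($) w) {0..<d}"
    by (rule L2_set_triangle_ineq)
  finally show ?thesis using assms by (simp add: vnorm_eq_L2_set)
qed

lemma vnorm_minus_commute:
  assumes "v \<in> carrier_vec d" "w \<in> carrier_vec d"
  shows "vnorm (v - w) = vnorm (w - v)"
  unfolding vnorm_def scalar_prod_def using assms
  by (intro arg_cong[of _ _ sqrt] sum.cong) (auto simp: algebra_simps)

lemma vnorm_minus_triangle:
  assumes "u \<in> carrier_vec d" "v \<in> carrier_vec d" "w \<in> carrier_vec d"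
  shows "vnorm (u - w) \<le> vnorm (u - v) + vnorm (v - w)"
proof -
  have "u - w = (u - v) + (v - w)" using assms by (intro eq_vecI) auto
  then show ?thesis using vnorm_add_le[of "u - v" d "v - w"] assms by simp
qed

lemma vnorm_smult_power2:
  assumes "v \<in> carrier_vec d"
  shows "(vnorm (s \<cdot>\<^sub>v v))\<^sup>2 = s\<^sup>2 * (vnorm v)\<^sup>2"
  unfolding vnorm_power2 using assms by (simp add: power2_eq_square)

lemma abs_scalar_prod_le_vnorm:
  assumes "v \<in> carrier_vec d" "w \<in> carrier_vec d"
  shows "\<bar>v \<bullet> w\<bar> \<le> vnorm v * vnorm w"
proof -
  have "\<bar>v \<bullet> w\<bar> \<le> (\<Sum>i = 0..<d. \<bar>v $ i\<bar> * \<bar>w $ i\<bar>)"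
    using assms unfolding scalar_prod_def by (auto intro: order.trans[OF sum_abs] simp: abs_mult)
  also have "\<dots> \<le> L2_set (($) v) {0..<d} * L2_set (($) w) {0..<d}"
    by (rule L2_set_mult_ineq)
  finally show ?thesis using assms by (simp add: vnorm_eq_L2_set)
qed

lemma abs_index_le_vnorm:
  assumes "v \<in> carrier_vec d" "i < d"
  shows "\<bar>v $ i\<bar> \<le> vnorm v"
  using abs_scalar_prod_le_vnorm[OF assms(1) unit_vec_carrier[of d i]] assms
  by (simp add: vnorm_def)

lemma mult_mat_vec_bounded:
  fixes A :: "real mat"
  obtains C :: real where "0 \<le> C" and "\<And>v :: real vec. v \<in> carrier_vec (dim_col A) \<Longrightarrow> vnorm (A *\<^sub>v v) \<le> C * vnorm v"
proof
  show "0 \<le> (\<Sum>i = 0..<dim_row A. vnorm (row A i))" by (simp add: sum_nonneg)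
next
  fix v :: "real vec" assume v: "v \<in> carrier_vec (dim_col A)"
  have "vnorm (A *\<^sub>v v) \<le> (\<Sum>i = 0..<dim_row A. \<bar>(A *\<^sub>v v) $ i\<bar>)"
    unfolding vnorm_eq_L2_set by (simp add: L2_set_le_sum_abs del: index_mult_mat_vec)
  also have "\<dots> \<le> (\<Sum>i = 0..<dim_row A. vnorm (row A i) * vnorm v)"
    using v by (intro sum_mono) (auto intro!: abs_scalar_prod_le_vnorm[of _ "dim_col A"])
  finally show "vnorm (A *\<^sub>v v) \<le> (\<Sum>i = 0..<dim_row A. vnorm (row A i)) * vnorm v"
    by (simp add: sum_distrib_right)
qed

section \<open>The trimmed penalty as a minimum of partial sums\<close>

text \<open>Subtracting the pivot \<open>b K\<close> from every term does not affect the comparison, since both sums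
  have \<open>d - K\<close> terms. Afterwards the tail collects all nonpositive terms and nothing else, so no
  index set can have a smaller sum.\<close>

lemma decreasing_tail_sum_le:
  fixes b :: "nat \<Rightarrow> real"
  assumes dec: "\<And>i j. i \<le> j \<Longrightarrow> j < d \<Longrightarrow> b j \<le> b i"
    and J: "J \<subseteq> {..<d}" "card J = d - K"
  shows "sum b {K..<d} \<le> sum b J"
proof (cases "K < d")
  case True
  have fin: "finite J" using J(1) finite_subset by blast
  have "(\<Sum>j\<in>{K..<d}. b j - b K) \<le> (\<Sum>j\<in>J \<inter> {K..<d}. b j - b K)"
    using dec[of K] by (intro sum_mono2[where f="\<lambda>j. - (b j - b K)", 
          simplified sum_negf neg_le_iff_le]) auto
  also have "\<dots> \<le> (\<Sum>j\<in>J. b j - b K)"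
    using dec[of _ K] True J(1) fin by (intro sum_mono2) (auto simp: not_le)
  finally show ?thesis using J(2) by (simp add: sum_subtractf)
next
  case False
  then show ?thesis using J finite_subset[OF J(1)] by auto
qed

lemma trimmed_l1_sorted:
  assumes z: "z \<in> carrier_vec d"
  obtains \<pi> where "bij_betw \<pi> {..<d} {..<d}"
    and "\<And>i j. i \<le> j \<Longrightarrow> j < d \<Longrightarrow> \<bar>z $ \<pi> j\<bar> \<le> \<bar>z $ \<pi> i\<bar>"
    and "trimmed_l1 K z = (\<Sum>i = K..<d. \<bar>z $ \<pi> i\<bar>)"
proof -
  let ?xs = "map abs (list_of_vec z)" and ?ys = "rev (sort (map abs (list_of_vec z)))"
  have len: "length ?xs = d" "length ?ys = d" using z by auto
  have "mset ?ys = mset ?xs" by simp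
  then obtain \<pi> where \<pi>: "\<pi> permutes {..<d}" and ys: "permute_list \<pi> ?xs = ?ys"
    using mset_eq_permutation len by metis
  have nth: "?ys ! i = \<bar>z $ \<pi> i\<bar>" if "i < d" for i
  proof -
    have "\<pi> i < d" using permutes_in_image[OF \<pi>, of i] that by simp
    then have "permute_list \<pi> ?xs ! i = \<bar>z $ \<pi> i\<bar>"
      using that \<pi> z len by (simp add: permute_list_nth list_of_vec_index)
    then show ?thesis using ys by simp
  qed
  show ?thesis
  proof
    show "bij_betw \<pi> {..<d} {..<d}" by (rule permutes_imp_bij[OF \<pi>])
    show "\<bar>z $ \<pi> j\<bar> \<le> \<bar>z $ \<pi> i\<bar>" if "i \<le> j" "j < d" for i j
      using sorted_rev_nth_mono[of ?ys i j] that nth[of i] nth[of j] len by simp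
    have "trimmed_l1 K z = (\<Sum>i = 0..<d - K. drop K ?ys ! i)"
      unfolding trimmed_l1_def sum_list_sum_nth using len by (simp only: length_drop)
    also have "\<dots> = (\<Sum>i = K..<d. ?ys ! i)"
      using len by (intro sum.reindex_bij_witness[of _ "\<lambda>i. i - K" "\<lambda>i. i + K"])
        (auto simp: add.commute)
    also have "\<dots> = (\<Sum>i = K..<d. \<bar>z $ \<pi> i\<bar>)" using nth by (intro sum.cong) auto
    finally show "trimmed_l1 K z = (\<Sum>i = K..<d. \<bar>z $ \<pi> i\<bar>)" .
  qed
qed

text \<open>The next two lemmas say that the penalty is the minimum of the partial sums over all index sets
  of size \<open>d - K\<close>. This turns a nonconvex function into a finite minimum of convex ones.\<close>

lemma trimmed_l1_le:
  assumes z: "z \<in> carrier_vec d" and I: "I \<subseteq> {..<d}" "card I = d - K"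
  shows "trimmed_l1 K z \<le> (\<Sum>i\<in>I. \<bar>z $ i\<bar>)"
proof -
  obtain \<pi> where bij: "bij_betw \<pi> {..<d} {..<d}"
    and dec: "\<And>i j. i \<le> j \<Longrightarrow> j < d \<Longrightarrow> \<bar>z $ \<pi> j\<bar> \<le> \<bar>z $ \<pi> i\<bar>"
    and eq: "trimmed_l1 K z = (\<Sum>i = K..<d. \<bar>z $ \<pi> i\<bar>)"
    using trimmed_l1_sorted[OF z] by blast
  define J where "J = {j \<in> {..<d}. \<pi> j \<in> I}"
  have inj: "inj_on \<pi> J" using bij unfolding J_def bij_betw_def by (auto intro: inj_on_subset)
  have im: "\<pi> ` J = I"
  proof
    show "\<pi> ` J \<subseteq> I" by (auto simp: J_def)
    show "I \<subseteq> \<pi> ` J"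
    proof
      fix i assume "i \<in> I"
      then obtain j where "j < d" "i = \<pi> j"
        using I(1) bij_betw_imp_surj_on[OF bij] by blast
      then show "i \<in> \<pi> ` J" using \<open>i \<in> I\<close> by (auto simp: J_def)
    qed
  qed
  have "card J = d - K" using card_image[OF inj] im I(2) by simp
  then have "(\<Sum>i = K..<d. \<bar>z $ \<pi> i\<bar>) \<le> (\<Sum>j\<in>J. \<bar>z $ \<pi> j\<bar>)"
    by (intro decreasing_tail_sum_le) (use dec J_def in auto)
  also have "\<dots> = (\<Sum>i\<in>I. \<bar>z $ i\<bar>)" using sum.reindex[OF inj, of "\<lambda>i. \<bar>z $ i\<bar>"] im by simp
  finally show ?thesis using eq by simp
qed

lemma trimmed_l1_attained:
  assumes z: "z \<in> carrier_vec d"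
  obtains I where "I \<subseteq> {..<d}" "card I = d - K" "trimmed_l1 K z = (\<Sum>i\<in>I. \<bar>z $ i\<bar>)"
proof -
  obtain \<pi> where bij: "bij_betw \<pi> {..<d} {..<d}"
    and eq: "trimmed_l1 K z = (\<Sum>i = K..<d. \<bar>z $ \<pi> i\<bar>)"
    using trimmed_l1_sorted[OF z] by metis
  have inj: "inj_on \<pi> {K..<d}" using bij unfolding bij_betw_def by (auto intro: inj_on_subset)
  show ?thesis
  proof
    show "\<pi> ` {K..<d} \<subseteq> {..<d}" using bij unfolding bij_betw_def by auto
    show "card (\<pi> ` {K..<d}) = d - K" using card_image[OF inj] by simp
    show "trimmed_l1 K z = (\<Sum>i\<in>\<pi> ` {K..<d}. \<bar>z $ i\<bar>)" using sum.reindex[OF inj, of "\<lambda>i. \<bar>z $ i\<bar>"] eq by simp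
  qed
qed

lemma trimmed_l1_nonneg: "0 \<le> trimmed_l1 K z"
proof -
  obtain I where "trimmed_l1 K z = (\<Sum>i\<in>I. \<bar>z $ i\<bar>)"
    using trimmed_l1_attained[OF carrier_vec_dim_vec[of z], of K] by blast
  then show ?thesis by (simp add: sum_nonneg)
qed

lemma sum_abs_lipschitz:
  assumes "a \<in> carrier_vec d" "w \<in> carrier_vec d" "I \<subseteq> {..<d}"
  shows "(\<Sum>i\<in>I. \<bar>a $ i\<bar>) - real d * vnorm (w - a) \<le> (\<Sum>i\<in>I. \<bar>w $ i\<bar>)"
proof -
  have "(\<Sum>i\<in>I. \<bar>a $ i\<bar> - \<bar>w $ i\<bar>) \<le> (\<Sum>i\<in>I. vnorm (w - a))"
  proof (rule sum_mono)
    fix i assume "i \<in> I"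
    then have "i < d" using assms by auto
    then show "\<bar>a $ i\<bar> - \<bar>w $ i\<bar> \<le> vnorm (w - a)"
      using abs_index_le_vnorm[of "w - a" d i] assms by auto
  qed
  also have "\<dots> \<le> real d * vnorm (w - a)"
    using card_mono[OF _ assms(3)] by (auto intro: mult_right_mono)
  finally show ?thesis by (simp add: sum_subtractf)
qed

lemma trimmed_l1_lipschitz:
  assumes "a \<in> carrier_vec d" "w \<in> carrier_vec d"
  shows "trimmed_l1 K a - real d * vnorm (w - a) \<le> trimmed_l1 K w"
proof -
  obtain I where I: "I \<subseteq> {..<d}" "card I = d - K" "trimmed_l1 K w = (\<Sum>i\<in>I. \<bar>w $ i\<bar>)"
    using trimmed_l1_attained[OF assms(2)] by metis
  then show ?thesis
    using trimmed_l1_le[OF assms(1) I(1,2)] sum_abs_lipschitz[OF assms I(1)] by linarith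
qed

section \<open>Nonmonotone descent\<close>

text \<open>The reference value \<open>W k\<close> is a maximum over a window, so the descent condition lets \<open>f\<close> increase
  for a while. Nevertheless \<open>W\<close> decreases to some \<open>\<omega>\<close>, and every window contains a value that is at
  least \<open>\<omega>\<close>. The point is to show that all late values are at least almost \<open>\<omega>\<close>, which forces the
  descent \<open>\<kappa> * \<delta> k\<close> to vanish. The growth bound does that: \<open>\<delta> k\<close> controls how much smaller than
  \<open>f (Suc k)\<close> the value \<open>f k\<close> can be. In the application \<open>\<delta>\<close> is the squared step length: with
  the square, a single proximal step yields the growth bound, wherever the iterates are.\<close>

lemma nonmonotone_descent_step_tendsto_0:
  fixes f \<delta> :: "nat \<Rightarrow> real" and mem :: nat
  defines "W \<equiv> \<lambda>k. Max (f ` {Suc k - mem..k})"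
  assumes mem: "1 \<le> mem" and f: "\<And>k. 0 \<le> f k" and \<delta>: "\<And>k. 0 \<le> \<delta> k"
    and \<kappa>: "0 < \<kappa>" and C: "0 \<le> C"
    and descent: "\<And>k. f (Suc k) \<le> W k - \<kappa> * \<delta> k"
    and growth: "\<And>k. f (Suc k) \<le> f k + C * \<delta> k"
  shows "\<delta> \<longlonglongrightarrow> 0"
proof -
  have f_le_W: "f s \<le> W k" if "Suc k - mem \<le> s" "s \<le> k" for s k
    unfolding W_def using that by (intro Max_ge) auto
  have window: "{Suc k - mem..k} \<noteq> {}" for k using mem by auto
  have "decseq W"
  proof (rule decseq_SucI)
    fix k
    have "f s \<le> W k" if "s \<in> {Suc (Suc k) - mem..Suc k}" for s
    proof (cases "s = Suc k")
      case True
      moreover have "0 \<le> \<kappa> * \<delta> k" using \<kappa> \<delta>[of k] by simp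
      ultimately show ?thesis using descent[of k] by simp
    next
      case False
      then show ?thesis using that by (intro f_le_W) auto
    qed
    then show "W (Suc k) \<le> W k"
      using window[of "Suc k"] unfolding W_def by (intro Max.boundedI) auto
  qed
  moreover have W_ge: "f k \<le> W k" for k using mem by (intro f_le_W) auto
  ultimately obtain \<omega> where lim: "W \<longlonglongrightarrow> \<omega>" and W_ge_\<omega>: "\<And>k. \<omega> \<le> W k"
    using decseq_convergent[of W 0] f order.trans by blast

  \<comment> \<open>If a value is almost \<open>\<omega>\<close>, then the step that led to it was short, so the value before it
    was almost \<open>\<omega>\<close> too.\<close>
  have near_before: "\<exists>e>0. \<forall>\<^sub>F k in sequentially. \<omega> - e \<le> f (k + j) \<longrightarrow> \<omega> - \<epsilon> \<le> f k"
    if "0 < \<epsilon>" for \<epsilon> j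
  proof (induction j)
    case 0
    then show ?case using that by (intro exI[of _ \<epsilon>]) auto
  next
    case (Suc j)
    then obtain e where e: "0 < e"
      and IH: "\<forall>\<^sub>F k in sequentially. \<omega> - e \<le> f (k + j) \<longrightarrow> \<omega> - \<epsilon> \<le> f k" by blast
    \<comment> \<open>A deficit of \<open>e'\<close> at the later index bounds \<open>\<delta>\<close> by \<open>2 * e' / \<kappa>\<close>, so the growth bound turns
      it into a deficit of at most \<open>e' + 2 * C * e' / \<kappa>\<close>.\<close>
    define e' where "e' = e / (1 + 2 * C / \<kappa>)"
    have pos: "0 < 1 + 2 * C / \<kappa>" using C \<kappa> by (simp add: add_pos_nonneg)
    then have e': "0 < e'" "e' * (1 + 2 * C / \<kappa>) = e" using e by (simp_all add: e'_def)
    have "\<forall>\<^sub>F k in sequentially. W k < \<omega> + e'"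
      using lim e' by (intro order_tendstoD(2)[OF lim]) auto
    then have "\<forall>\<^sub>F k in sequentially. W (k + j) < \<omega> + e'"
      by (rule sequentially_offset)
    with IH have "\<forall>\<^sub>F k in sequentially. \<omega> - e' \<le> f (k + Suc j) \<longrightarrow> \<omega> - \<epsilon> \<le> f k"
    proof eventually_elim
      case (elim k)
      show ?case
      proof
        assume large: "\<omega> - e' \<le> f (k + Suc j)"
        have "\<kappa> * \<delta> (k + j) \<le> 2 * e'" using descent[of "k + j"] large elim by simp
        then have "\<delta> (k + j) \<le> 2 * e' / \<kappa>" using \<kappa> by (simp add: field_simps)
        then have "C * \<delta> (k + j) \<le> C * (2 * e' / \<kappa>)" using C by (intro mult_left_mono)
        moreover have "e' + C * (2 * e' / \<kappa>) = e" using e'(2) by (simp add: field_simps)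
        ultimately have "\<omega> - e \<le> f (k + j)" using growth[of "k + j"] large by simp
        then show "\<omega> - \<epsilon> \<le> f k" using elim by simp
      qed
    qed
    then show ?case using e' by blast
  qed

  have "f \<longlonglongrightarrow> \<omega>"
  proof (rule order_tendstoI)
    fix u assume "u < \<omega>"
    define \<epsilon> where "\<epsilon> = (\<omega> - u) / 2"
    have \<epsilon>: "0 < \<epsilon>" "u < \<omega> - \<epsilon>" using \<open>u < \<omega>\<close> by (auto simp: \<epsilon>_def field_simps)
    have "\<forall>\<^sub>F k in sequentially. \<omega> \<le> f (k + j) \<longrightarrow> \<omega> - \<epsilon> \<le> f k" for j
    proof -
      obtain e where "0 < e" and ev: "\<forall>\<^sub>F k in sequentially. \<omega> - e \<le> f (k + j) \<longrightarrow> \<omega> - \<epsilon> \<le> f k"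
        using near_before[OF \<epsilon>(1)] by blast
      show ?thesis using ev by eventually_elim (use \<open>0 < e\<close> in auto)
    qed
    then have "\<forall>\<^sub>F k in sequentially. \<forall>j\<in>{..mem}. \<omega> \<le> f (k + j) \<longrightarrow> \<omega> - \<epsilon> \<le> f k"
      by (intro eventually_ball_finite) auto
    then show "\<forall>\<^sub>F k in sequentially. u < f k"
    proof eventually_elim
      case (elim k)
      \<comment> \<open>The maximum over the window that ends at \<open>k + mem\<close> is attained after \<open>k\<close>.\<close>
      have "W (k + mem) \<in> f ` {Suc (k + mem) - mem..k + mem}"
        unfolding W_def using window[of "k + mem"] by (intro Max_in) auto
      then obtain s where s: "W (k + mem) = f s" "k \<le> s" "s \<le> k + mem" by auto
      then have "\<omega> \<le> f (k + (s - k))" using W_ge_\<omega>[of "k + mem"] by simp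
      moreover have "s - k \<in> {..mem}" using s by simp
      ultimately have "\<omega> - \<epsilon> \<le> f k" using elim by blast
      then show ?case using \<epsilon>(2) by simp
    qed
  next
    fix u assume "\<omega> < u"
    then have "\<forall>\<^sub>F k in sequentially. W k < u" by (rule order_tendstoD(2)[OF lim])
    then show "\<forall>\<^sub>F k in sequentially. f k < u"
      by eventually_elim (use W_ge in \<open>auto intro: le_less_trans\<close>)
  qed
  then have "(\<lambda>k. f (Suc k)) \<longlonglongrightarrow> \<omega>" by (rule LIMSEQ_Suc)
  then have "(\<lambda>k. (W k - f (Suc k)) / \<kappa>) \<longlonglongrightarrow> (\<omega> - \<omega>) / \<kappa>"
    using lim \<kappa> by (intro tendsto_intros) auto
  then have "(\<lambda>k. (W k - f (Suc k)) / \<kappa>) \<longlonglongrightarrow> 0" by simp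
  moreover have "\<delta> k \<le> (W k - f (Suc k)) / \<kappa>" for k
    using descent[of k] \<kappa> by (simp add: field_simps)
  ultimately show ?thesis
    using \<delta> by (intro real_tendsto_sandwich[of "\<lambda>_. 0" \<delta>]) auto
qed

section \<open>Local minima of finite minima of convex functions\<close>

text \<open>If \<open>f i\<close> is active at \<open>a\<close>, then \<open>f i a = F a \<le> f i w + O(|w - a|\<^sup>2)\<close>. A convex function that
  satisfies such an inequality at \<open>a\<close> is globally minimal there: shrink \<open>w\<close> towards \<open>a\<close>, the
  quadratic term vanishes faster than the linear one. An inactive \<open>f i\<close> exceeds \<open>F a\<close> at \<open>a\<close>, hence
  near \<open>a\<close>. So near \<open>a\<close> whichever \<open>f i\<close> attains \<open>F\<close> is at least \<open>F a\<close>.\<close>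

lemma quadratic_minorant_finite_min_local_min:
  fixes f :: "'i \<Rightarrow> real vec \<Rightarrow> real"
  assumes a: "a \<in> carrier_vec d" and fin: "finite \<I>"
    and le: "\<And>i w. i \<in> \<I> \<Longrightarrow> w \<in> carrier_vec d \<Longrightarrow> F w \<le> f i w"
    and attained: "\<And>w. w \<in> carrier_vec d \<Longrightarrow> \<exists>i\<in>\<I>. F w = f i w"
    and lower: "\<And>i w. i \<in> \<I> \<Longrightarrow> w \<in> carrier_vec d \<Longrightarrow> f i a - C * vnorm (w - a) \<le> f i w"
    and convex: "\<And>i w s. i \<in> \<I> \<Longrightarrow> w \<in> carrier_vec d \<Longrightarrow> 0 < s \<Longrightarrow> s < 1 \<Longrightarrow>
        f i (a + s \<cdot>\<^sub>v (w - a)) \<le> (1 - s) * f i a + s * f i w"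
    and quad: "\<And>w. w \<in> carrier_vec d \<Longrightarrow> F a \<le> F w + \<eta> / 2 * (vnorm (w - a))\<^sup>2"
  shows "is_local_min d F a"
proof -
  have active: "F a \<le> f i w" if i: "i \<in> \<I>" "f i a = F a" and w: "w \<in> carrier_vec d" for i w
  proof -
    let ?q = "\<eta> / 2 * (vnorm (w - a))\<^sup>2"
    have "F a - f i w \<le> s * ?q" if s: "0 < s" "s < 1" for s
    proof -
      have u: "a + s \<cdot>\<^sub>v (w - a) \<in> carrier_vec d" using a w by auto
      have "a + s \<cdot>\<^sub>v (w - a) - a = s \<cdot>\<^sub>v (w - a)" using a w by (intro eq_vecI) auto
      then have "(vnorm (a + s \<cdot>\<^sub>v (w - a) - a))\<^sup>2 = s\<^sup>2 * (vnorm (w - a))\<^sup>2"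
        using vnorm_smult_power2[of "w - a" d s] a w by simp
      then have "F a \<le> (1 - s) * f i a + s * f i w + s\<^sup>2 * ?q"
        using quad[OF u] le[OF i(1) u] convex[OF i(1) w s] by (simp add: algebra_simps)
      then have "s * (F a - f i w) \<le> s * (s * ?q)"
        using i(2) by (simp add: algebra_simps power2_eq_square)
      then show ?thesis using s(1) by simp
    qed
    then have "\<forall>\<^sub>F s in at_right 0. F a - f i w \<le> s * ?q"
      unfolding eventually_at_right_field by (intro exI[of _ 1]) auto
    moreover have "((\<lambda>s. s * ?q) \<longlongrightarrow> 0 * ?q) (at_right 0)" by (intro tendsto_intros)
    ultimately have "F a - f i w \<le> 0 * ?q"
      by (intro tendsto_lowerbound[of _ _ "at_right 0"]) auto
    then show ?thesis by simp
  qed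
  \<comment> \<open>The inactive indices: each leaves a gap, and finitely many gaps have a common radius.\<close>
  define \<J> where "\<J> = {i \<in> \<I>. f i a \<noteq> F a}"
  have "\<forall>\<^sub>F e in at_right (0::real). \<forall>i\<in>\<J>. F a < f i a - \<bar>C\<bar> * e"
  proof (intro eventually_ball_finite ballI)
    show "finite \<J>" using fin by (simp add: \<J>_def)
    fix i assume "i \<in> \<J>"
    then have "F a < f i a - \<bar>C\<bar> * 0" using le[of i a] a by (force simp: \<J>_def)
    moreover have "((\<lambda>e. f i a - \<bar>C\<bar> * e) \<longlongrightarrow> f i a - \<bar>C\<bar> * 0) (at_right 0)"
      by (intro tendsto_intros)
    ultimately show "\<forall>\<^sub>F e in at_right 0. F a < f i a - \<bar>C\<bar> * e"
      by (intro order_tendstoD(1))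
  qed
  then obtain b where b: "0 < b" "\<And>e i. 0 < e \<Longrightarrow> e < b \<Longrightarrow> i \<in> \<J> \<Longrightarrow> F a < f i a - \<bar>C\<bar> * e"
    unfolding eventually_at_right_field by blast
  define e where "e = b / 2"
  have e: "0 < e" "\<And>i. i \<in> \<J> \<Longrightarrow> F a < f i a - \<bar>C\<bar> * e" using b(1) b(2)[of e] by (auto simp: e_def)
  have "F a \<le> F w" if w: "w \<in> carrier_vec d" "vnorm (w - a) < e" for w
  proof -
    obtain i where i: "i \<in> \<I>" "F w = f i w" using attained[OF w(1)] by blast
    show ?thesis
    proof (cases "f i a = F a")
      case True
      then show ?thesis using active[OF i(1) _ w(1)] i(2) by simp
    next
      case False
      have "C * vnorm (w - a) \<le> \<bar>C\<bar> * e"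
        using w(2) by (intro mult_mono) auto
      then show ?thesis using lower[OF i(1) w(1)] e(2)[of i] False i by (simp add: \<J>_def)
    qed
  qed
  then show ?thesis using a e(1) unfolding is_local_min_def by blast
qed

section \<open>Accumulation points of the proximal gradient iteration\<close>

lemma gist_search_carrier: "gist_search d h \<phi> \<rho> \<sigma> R b \<eta> w \<Longrightarrow> w \<in> carrier_vec d"
  by (induction rule: gist_search.induct) (simp_all add: prox_def is_arg_min_def)

lemma gist_sequence_carrier:
  assumes "gist_sequence d h \<phi> \<rho> \<eta>lo \<eta>hi \<sigma> mem \<beta>"
  shows "\<beta> k \<in> carrier_vec d"
proof (cases k)
  case 0
  then show ?thesis using assms by (simp add: gist_sequence_def)
next
  case (Suc j)
  have "\<exists>R \<eta>. gist_search d h \<phi> \<rho> \<sigma> R (\<beta> j) \<eta> (\<beta> (Suc j))"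
    using assms unfolding gist_sequence_def by blast
  then show ?thesis using gist_search_carrier Suc by blast
qed

text \<open>The argument sees the gradient of \<open>h\<close> only through two inequalities: the tangent plane lies
  below \<open>h\<close>, and at most \<open>L / 2 * |w - b|\<^sup>2\<close> below it.\<close>

locale smooth_convex_composite =
  fixes d :: nat and h \<phi> :: "real vec \<Rightarrow> real" and L :: real
  assumes L_pos: "0 < L"
    and h_nonneg: "\<And>b. b \<in> carrier_vec d \<Longrightarrow> 0 \<le> h b"
    and \<phi>_nonneg: "\<And>b. b \<in> carrier_vec d \<Longrightarrow> 0 \<le> \<phi> b"
    and subgradient: "\<And>b w. b \<in> carrier_vec d \<Longrightarrow> w \<in> carrier_vec d \<Longrightarrow>
          h b + gradient d h b \<bullet> (w - b) \<le> h w"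
    and smooth: "\<And>b w. b \<in> carrier_vec d \<Longrightarrow> w \<in> carrier_vec d \<Longrightarrow>
          h w \<le> h b + gradient d h b \<bullet> (w - b) + L / 2 * (vnorm (w - b))\<^sup>2"
begin

abbreviation prox_step :: "real \<Rightarrow> real vec \<Rightarrow> real vec set" where
  "prox_step \<eta> b \<equiv> prox d (\<lambda>z. \<phi> z / \<eta>) (b - (1 / \<eta>) \<cdot>\<^sub>v gradient d h b)"

lemma gradient_carrier: "gradient d h b \<in> carrier_vec d"
  by (simp add: gradient_def)

lemma h_convex:
  assumes a: "a \<in> carrier_vec d" and w: "w \<in> carrier_vec d" and s: "0 \<le> s" "s \<le> 1"
  shows "h (a + s \<cdot>\<^sub>v (w - a)) \<le> (1 - s) * h a + s * h w"
proof -
  let ?u = "a + s \<cdot>\<^sub>v (w - a)" and ?p = "gradient d h (a + s \<cdot>\<^sub>v (w - a)) \<bullet> (w - a)"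
  have u: "?u \<in> carrier_vec d" using a w by auto
  have "a - ?u = (- s) \<cdot>\<^sub>v (w - a)" "w - ?u = (1 - s) \<cdot>\<^sub>v (w - a)"
    using a w by (auto intro!: eq_vecI simp: algebra_simps)
  then have "h ?u + (- s) * ?p \<le> h a" "h ?u + (1 - s) * ?p \<le> h w"
    using subgradient[OF u a] subgradient[OF u w] gradient_carrier[of ?u] a w by simp_all
  then have "(1 - s) * (h ?u + (- s) * ?p) + s * (h ?u + (1 - s) * ?p) \<le> (1 - s) * h a + s * h w"
    using s by (intro add_mono mult_left_mono) auto
  then show ?thesis by (simp add: algebra_simps)
qed

lemma prox_step_carrier: "w \<in> prox_step \<eta> b \<Longrightarrow> w \<in> carrier_vec d"
  by (simp add: prox_def is_arg_min_def)

text \<open>Multiplying the proximal objective by \<open>\<eta>\<close> and completing the square shows that the step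
  minimizes \<open>\<phi>\<close> plus the linearization of \<open>h\<close> at \<open>b\<close> plus \<open>\<eta> / 2 * |z - b|\<^sup>2\<close>.\<close>

lemma prox_step_model:
  assumes b: "b \<in> carrier_vec d" and z: "z \<in> carrier_vec d" and \<eta>: "0 < \<eta>"
    and w: "w \<in> prox_step \<eta> b"
  shows "\<phi> w + gradient d h b \<bullet> (w - b) + \<eta> / 2 * (vnorm (w - b))\<^sup>2
       \<le> \<phi> z + gradient d h b \<bullet> (z - b) + \<eta> / 2 * (vnorm (z - b))\<^sup>2"
proof -
  let ?G = "gradient d h b"
  have square: "\<eta> * (1 / 2 * (vnorm (v - (b - (1 / \<eta>) \<cdot>\<^sub>v ?G)))\<^sup>2)
      = \<eta> / 2 * (vnorm (v - b))\<^sup>2 + ?G \<bullet> (v - b) + (?G \<bullet> ?G) / (2 * \<eta>)"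
    if v: "v \<in> carrier_vec d" for v
  proof -
    have shift: "v - (b - (1 / \<eta>) \<cdot>\<^sub>v ?G) = (v - b) + (1 / \<eta>) \<cdot>\<^sub>v ?G"
      using v b carrier_vecD[OF gradient_carrier[of b]] by (intro eq_vecI) auto
    have expand: "(vnorm ((v - b) + (1 / \<eta>) \<cdot>\<^sub>v ?G))\<^sup>2
        = (vnorm (v - b))\<^sup>2 + 2 / \<eta> * (?G \<bullet> (v - b)) + (?G \<bullet> ?G) / \<eta>\<^sup>2"
      using v b gradient_carrier[of b] \<eta> unfolding vnorm_power2
      by (simp add: add_scalar_prod_distrib[of _ d] scalar_prod_add_distrib[of _ d]
          comm_scalar_prod[of "v - b" d ?G] power2_eq_square field_simps)
    show ?thesis
      unfolding shift expand using \<eta> by (simp add: field_simps power2_eq_square)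
  qed
  have wc: "w \<in> carrier_vec d" using prox_step_carrier[OF w] .
  have "\<phi> w / \<eta> + 1 / 2 * (vnorm (w - (b - (1 / \<eta>) \<cdot>\<^sub>v ?G)))\<^sup>2
      \<le> \<phi> z / \<eta> + 1 / 2 * (vnorm (z - (b - (1 / \<eta>) \<cdot>\<^sub>v ?G)))\<^sup>2"
    using w z by (auto simp: prox_def is_arg_min_def not_less)
  then have "\<eta> * (\<phi> w / \<eta> + 1 / 2 * (vnorm (w - (b - (1 / \<eta>) \<cdot>\<^sub>v ?G)))\<^sup>2)
      \<le> \<eta> * (\<phi> z / \<eta> + 1 / 2 * (vnorm (z - (b - (1 / \<eta>) \<cdot>\<^sub>v ?G)))\<^sup>2)"
    using \<eta> by (intro mult_left_mono) auto
  then show ?thesis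
    unfolding distrib_left square[OF wc] square[OF z] using \<eta> by simp
qed

text \<open>The linear terms are eliminated: smoothness bounds the one at \<open>w\<close> from below by \<open>h w - h b\<close>
  up to a quadratic error, convexity bounds the one at \<open>z\<close> from above by \<open>h z - h b\<close>. The choice
  \<open>z = b\<close> gives sufficient decrease for large \<open>\<eta>\<close> and a growth bound for every \<open>\<eta>\<close>; for arbitrary
  \<open>z\<close> the inequality mentions only values of the objective, so it can be passed to the limit.\<close>

lemma prox_step_objective:
  assumes b: "b \<in> carrier_vec d" and z: "z \<in> carrier_vec d" and \<eta>: "0 < \<eta>"
    and w: "w \<in> prox_step \<eta> b"
  shows "h w + \<phi> w + (\<eta> - L) / 2 * (vnorm (w - b))\<^sup>2 \<le> h z + \<phi> z + \<eta> / 2 * (vnorm (z - b))\<^sup>2"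
  using prox_step_model[OF assms] smooth[OF b prox_step_carrier[OF w]] subgradient[OF b z]
  by (simp add: field_simps)

text \<open>A rejected parameter is below \<open>L / (1 - \<sigma>)\<close>, by sufficient decrease. The accepted one is
  \<open>\<rho>\<close> times the last rejected one, or the first one tried; so accepted parameters stay bounded,
  however often the search retries.\<close>

lemma gist_search_accepts:
  assumes "gist_search d h \<phi> \<rho> \<sigma> R b \<eta> w"
    and b: "b \<in> carrier_vec d" and R: "h b + \<phi> b \<le> R" and "0 < \<eta>" and \<rho>: "1 < \<rho>" and \<sigma>: "\<sigma> < 1"
  shows "\<exists>\<eta>'. \<rho> * \<eta> \<le> \<eta>' \<and> \<eta>' \<le> max (\<rho> * \<eta>) (\<rho> * (L / (1 - \<sigma>))) \<and> w \<in> prox_step \<eta>' b \<and>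
      h w + \<phi> w \<le> R - \<sigma> * \<eta>' / 2 * (vnorm (w - b))\<^sup>2"
  using assms(1,4)
proof (induction rule: gist_search.induct)
  case (accept \<eta>' \<eta> w)
  then show ?case by (intro exI[of _ \<eta>']) auto
next
  case (retry \<eta>' \<eta> w' w)
  have pos: "0 < \<eta>'" using retry \<rho> by simp
  have small: "\<eta>' < L / (1 - \<sigma>)"
  proof (rule ccontr)
    assume "\<not> ?thesis"
    then have "\<sigma> * \<eta>' \<le> \<eta>' - L" using \<sigma> by (simp add: field_simps)
    then have "\<sigma> * \<eta>' / 2 * (vnorm (w' - b))\<^sup>2 \<le> (\<eta>' - L) / 2 * (vnorm (w' - b))\<^sup>2"
      by (intro mult_right_mono) auto
    moreover have "vnorm (b - b) = 0" using b by (simp add: vnorm_eq_0_iff[of _ d])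
    ultimately have "h w' + \<phi> w' \<le> R - \<sigma> * \<eta>' / 2 * (vnorm (w' - b))\<^sup>2"
      using prox_step_objective[OF b b pos retry(2)] R by simp
    then show False using retry(3) by simp
  qed
  have larger: "\<rho> * \<eta> \<le> \<rho> * \<eta>'"
    using mult_right_mono[of 1 \<rho> \<eta>'] retry(1) pos \<rho> by simp
  obtain \<eta>'' where IH: "\<rho> * \<eta>' \<le> \<eta>''" "\<eta>'' \<le> max (\<rho> * \<eta>') (\<rho> * (L / (1 - \<sigma>)))"
    "w \<in> prox_step \<eta>'' b" "h w + \<phi> w \<le> R - \<sigma> * \<eta>'' / 2 * (vnorm (w - b))\<^sup>2"
    using retry.IH[OF pos] by blast
  have "\<rho> * \<eta>' \<le> \<rho> * (L / (1 - \<sigma>))" using small \<rho> by (intro mult_left_mono) auto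
  then show ?case using IH larger by (intro exI[of _ \<eta>'']) auto
qed

text \<open>The step lemma says that \<open>F (\<beta> (Suc k))\<close> is at most \<open>F z + E / 2 * |z - \<beta> k|\<^sup>2\<close> up to a multiple
  of the squared step length, with a fixed bound \<open>E\<close> on the accepted parameters. The step lengths
  tend to 0 along the whole sequence, hence \<open>\<beta> (r k)\<close> and \<open>\<beta> (Suc (r k))\<close> have the same limit \<open>a\<close>,
  and the inequality passes to that limit by lower semicontinuity of \<open>F\<close> at \<open>a\<close>.\<close>

theorem gist_accumulation_point_quadratic_minorant:
  assumes gist: "gist_sequence d h \<phi> \<rho> \<eta>lo \<eta>hi \<sigma> mem \<beta>"
    and \<rho>: "1 < \<rho>" and \<eta>lo: "0 < \<eta>lo" "\<eta>lo \<le> \<eta>hi" and \<sigma>: "0 < \<sigma>" "\<sigma> < 1" and mem: "1 \<le> mem"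
    and acc: "is_accumulation_point d \<beta> a"
    and \<phi>_lower: "\<And>w. w \<in> carrier_vec d \<Longrightarrow> \<phi> a - C * vnorm (w - a) \<le> \<phi> w"
  obtains E where "\<And>z. z \<in> carrier_vec d \<Longrightarrow> h a + \<phi> a \<le> h z + \<phi> z + E / 2 * (vnorm (z - a))\<^sup>2"
proof -
  define F where "F z = h z + \<phi> z" for z
  define \<delta> where "\<delta> k = (vnorm (\<beta> (Suc k) - \<beta> k))\<^sup>2" for k
  define E where "E = max \<eta>hi (\<rho> * (L / (1 - \<sigma>)))"
  define R where "R k = Max ((\<lambda>s. F (\<beta> s)) ` {Suc k - mem..k})" for k
  obtain \<eta> where \<eta>0: "\<eta> 0 \<in> {\<eta>lo / \<rho>..\<eta>hi / \<rho>}"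
    and search: "\<And>k. gist_search d h \<phi> \<rho> \<sigma> (R k) (\<beta> k) (\<eta> k) (\<beta> (Suc k))"
    and next_\<eta>: "\<And>k. \<exists>r. \<eta> (Suc k) = 1 / \<rho> * min \<eta>hi (max \<eta>lo r)"
    using gist unfolding gist_sequence_def R_def F_def by metis
  have \<eta>_range: "\<eta>lo \<le> \<rho> * \<eta> k" "\<rho> * \<eta> k \<le> \<eta>hi" "0 < \<eta> k" for k
  proof -
    show lo: "\<eta>lo \<le> \<rho> * \<eta> k"
    proof (cases k)
      case 0
      then show ?thesis using \<eta>0 \<rho> by (simp add: field_simps)
    next
      case (Suc j)
      then show ?thesis using next_\<eta>[of j] \<rho> \<eta>lo by auto
    qed
    show "\<rho> * \<eta> k \<le> \<eta>hi"
    proof (cases k)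
      case 0
      then show ?thesis using \<eta>0 \<rho> by (simp add: field_simps)
    next
      case (Suc j)
      then show ?thesis using next_\<eta>[of j] \<rho> \<eta>lo by auto
    qed
    show "0 < \<eta> k" using lo \<eta>lo \<rho> by (intro zero_less_mult_pos[of \<rho> "\<eta> k"]) auto
  qed
  have \<beta>: "\<beta> k \<in> carrier_vec d" for k using gist by (rule gist_sequence_carrier)
  have step: "\<exists>\<eta>'. \<eta>lo \<le> \<eta>' \<and> \<eta>' \<le> E \<and> \<beta> (Suc k) \<in> prox_step \<eta>' (\<beta> k) \<and>
      F (\<beta> (Suc k)) \<le> R k - \<sigma> * \<eta>' / 2 * \<delta> k" for k
  proof -
    have "F (\<beta> k) \<le> R k" unfolding R_def using mem by (intro Max_ge) auto
    then obtain \<eta>' where \<eta>': "\<rho> * \<eta> k \<le> \<eta>'" "\<eta>' \<le> max (\<rho> * \<eta> k) (\<rho> * (L / (1 - \<sigma>)))"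
      "\<beta> (Suc k) \<in> prox_step \<eta>' (\<beta> k)" "F (\<beta> (Suc k)) \<le> R k - \<sigma> * \<eta>' / 2 * \<delta> k"
      using gist_search_accepts[OF search \<beta> _ \<eta>_range(3) \<rho> \<sigma>(2)]
      unfolding F_def \<delta>_def by blast
    then have "\<eta>lo \<le> \<eta>'" "\<eta>' \<le> E" using \<eta>_range(1,2)[of k] by (auto simp: E_def)
    then show ?thesis using \<eta>'(3,4) by blast
  qed
  have descent: "F (\<beta> (Suc k)) \<le> R k - \<sigma> * \<eta>lo / 2 * \<delta> k" for k
  proof -
    obtain \<eta>' where \<eta>': "\<eta>lo \<le> \<eta>'" "F (\<beta> (Suc k)) \<le> R k - \<sigma> * \<eta>' / 2 * \<delta> k"
      using step by blast
    have "\<sigma> * \<eta>lo / 2 * \<delta> k \<le> \<sigma> * \<eta>' / 2 * \<delta> k"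
      using \<eta>'(1) \<sigma> by (intro mult_right_mono) (auto simp: \<delta>_def)
    then show ?thesis using \<eta>'(2) by simp
  qed
  have compare: "F (\<beta> (Suc k)) \<le> F z + E / 2 * (vnorm (z - \<beta> k))\<^sup>2 + L / 2 * \<delta> k"
    if z: "z \<in> carrier_vec d" for k z
  proof -
    obtain \<eta>' where \<eta>': "\<eta>lo \<le> \<eta>'" "\<eta>' \<le> E" "\<beta> (Suc k) \<in> prox_step \<eta>' (\<beta> k)"
      using step by blast
    have "\<eta>' / 2 * (vnorm (z - \<beta> k))\<^sup>2 \<le> E / 2 * (vnorm (z - \<beta> k))\<^sup>2"
      using \<eta>'(2) by (intro mult_right_mono) auto
    moreover have "0 \<le> \<eta>' / 2 * \<delta> k" using \<eta>' \<eta>lo by (simp add: \<delta>_def)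
    moreover have "F (\<beta> (Suc k)) + (\<eta>' - L) / 2 * \<delta> k \<le> F z + \<eta>' / 2 * (vnorm (z - \<beta> k))\<^sup>2"
      using prox_step_objective[OF \<beta> z _ \<eta>'(3)] \<eta>' \<eta>lo unfolding F_def \<delta>_def by simp
    moreover have "(\<eta>' - L) / 2 * \<delta> k = \<eta>' / 2 * \<delta> k - L / 2 * \<delta> k" by (simp add: field_simps)
    ultimately show ?thesis by linarith
  qed
  have "\<delta> \<longlonglongrightarrow> 0"
  proof (rule nonmonotone_descent_step_tendsto_0[where f = "\<lambda>k. F (\<beta> k)" and mem = mem])
    show "0 \<le> F (\<beta> k)" for k using h_nonneg \<phi>_nonneg \<beta> by (simp add: F_def)
    show "F (\<beta> (Suc k)) \<le> Max ((\<lambda>k. F (\<beta> k)) ` {Suc k - mem..k}) - \<sigma> * \<eta>lo / 2 * \<delta> k" for k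
      using descent unfolding R_def .
    have "vnorm (\<beta> k - \<beta> k) = 0" for k using \<beta>[of k] by (simp add: vnorm_eq_0_iff[of _ d])
    then show "F (\<beta> (Suc k)) \<le> F (\<beta> k) + L / 2 * \<delta> k" for k
      using compare[OF \<beta>, of k k] by simp
  qed (use mem \<sigma> \<eta>lo L_pos in \<open>auto simp: \<delta>_def\<close>)

  obtain r where a: "a \<in> carrier_vec d" and r: "strict_mono r"
    and lim_r: "(\<lambda>k. vnorm (\<beta> (r k) - a)) \<longlonglongrightarrow> 0"
    using acc unfolding is_accumulation_point_def by blast
  have lim_\<delta>: "(\<lambda>k. \<delta> (r k)) \<longlonglongrightarrow> 0"
    using LIMSEQ_subseq_LIMSEQ[OF \<open>\<delta> \<longlonglongrightarrow> 0\<close> r] by (simp add: o_def)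
  have "(\<lambda>k. sqrt (\<delta> (r k)) + vnorm (\<beta> (r k) - a)) \<longlonglongrightarrow> sqrt 0 + 0"
    by (intro tendsto_intros lim_\<delta> lim_r)
  then have lim_bound: "(\<lambda>k. sqrt (\<delta> (r k)) + vnorm (\<beta> (r k) - a)) \<longlonglongrightarrow> 0" by simp
  have bound: "vnorm (\<beta> (Suc (r k)) - a) \<le> sqrt (\<delta> (r k)) + vnorm (\<beta> (r k) - a)" for k
    using vnorm_minus_triangle[OF \<beta> \<beta> a, of "Suc (r k)" "r k"] by (simp add: \<delta>_def)
  have lim_Suc: "(\<lambda>k. vnorm (\<beta> (Suc (r k)) - a)) \<longlonglongrightarrow> 0"
    by (rule tendsto_0_le[where K = 1, OF lim_bound])
      (auto intro!: always_eventually order.trans[OF bound abs_ge_self])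
  \<comment> \<open>The linear minorants of \<open>h\<close> and \<open>\<phi>\<close> at \<open>a\<close> make \<open>F\<close> lower semicontinuous there.\<close>
  define D where "D = C + vnorm (gradient d h a)"
  have F_lower: "F a - D * vnorm (w - a) \<le> F w" if w: "w \<in> carrier_vec d" for w
    using subgradient[OF a w] \<phi>_lower[OF w]
      abs_scalar_prod_le_vnorm[OF gradient_carrier[of a], of "w - a"] a w
    by (simp add: F_def D_def algebra_simps abs_le_iff)
  show ?thesis
  proof
    fix z :: "real vec" assume z: "z \<in> carrier_vec d"
    let ?lower = "\<lambda>k. F a - D * vnorm (\<beta> (Suc (r k)) - a)"
    let ?upper = "\<lambda>k. F z + E / 2 * (vnorm (z - a) + vnorm (\<beta> (r k) - a))\<^sup>2 + L / 2 * \<delta> (r k)"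
    have "0 \<le> E" using \<eta>lo by (auto simp: E_def)
    have "?lower k \<le> ?upper k" for k
    proof -
      have "vnorm (z - \<beta> (r k)) \<le> vnorm (z - a) + vnorm (\<beta> (r k) - a)"
        using vnorm_minus_triangle[OF z a \<beta>] vnorm_minus_commute[OF a \<beta>] by simp
      then have "E / 2 * (vnorm (z - \<beta> (r k)))\<^sup>2 \<le> E / 2 * (vnorm (z - a) + vnorm (\<beta> (r k) - a))\<^sup>2"
        using \<open>0 \<le> E\<close> by (intro mult_left_mono power_mono) auto
      then show ?thesis using F_lower[OF \<beta>, of "Suc (r k)"] compare[OF z, of "r k"] by simp
    qed
    moreover have "?lower \<longlonglongrightarrow> F a - D * 0" by (intro tendsto_intros lim_Suc)
    moreover have "?upper \<longlonglongrightarrow> F z + E / 2 * (vnorm (z - a) + 0)\<^sup>2 + L / 2 * 0"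
      by (intro tendsto_intros lim_r lim_\<delta>)
    ultimately have "F a - D * 0 \<le> F z + E / 2 * (vnorm (z - a) + 0)\<^sup>2 + L / 2 * 0"
      by (intro LIMSEQ_le) auto
    then show "h a + \<phi> a \<le> h z + \<phi> z + E / 2 * (vnorm (z - a))\<^sup>2" by (simp add: F_def)
  qed
qed

text \<open>The objective is the minimum over index sets \<open>I\<close> of \<open>h\<close> plus a multiple of the partial sum of
  absolute values over \<open>I\<close>, each of which is convex.\<close>

theorem gist_trimmed_l1_local_min:
  assumes \<phi>: "\<phi> = (\<lambda>b. \<gamma> * trimmed_l1 K b)" and \<gamma>: "0 \<le> \<gamma>"
    and gist: "gist_sequence d h \<phi> \<rho> \<eta>lo \<eta>hi \<sigma> mem \<beta>"
    and \<rho>: "1 < \<rho>" and \<eta>lo: "0 < \<eta>lo" "\<eta>lo \<le> \<eta>hi" and \<sigma>: "0 < \<sigma>" "\<sigma> < 1" and mem: "1 \<le> mem"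
    and acc: "is_accumulation_point d \<beta> a"
  shows "is_local_min d (\<lambda>b. h b + \<phi> b) a"
proof -
  have a: "a \<in> carrier_vec d" using acc by (simp add: is_accumulation_point_def)
  have "\<phi> a - \<gamma> * real d * vnorm (w - a) \<le> \<phi> w" if "w \<in> carrier_vec d" for w
    using mult_left_mono[OF trimmed_l1_lipschitz[OF a that, of K] \<gamma>] by (simp add: \<phi> algebra_simps)
  then obtain E where E: "\<And>z. z \<in> carrier_vec d \<Longrightarrow>
      h a + \<phi> a \<le> h z + \<phi> z + E / 2 * (vnorm (z - a))\<^sup>2"
    using gist_accumulation_point_quadratic_minorant[OF gist \<rho> \<eta>lo \<sigma> mem acc, of "\<gamma> * real d"]
    by blast
  define \<I> where "\<I> = {I. I \<subseteq> {..<d} \<and> card I = d - K}"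
  define f where "f I b = h b + \<gamma> * (\<Sum>i\<in>I. \<bar>b $ i\<bar>)" for I and b :: "real vec"
  show ?thesis
  proof (rule quadratic_minorant_finite_min_local_min[where f = f and \<I> = \<I> and \<eta> = E
        and C = "vnorm (gradient d h a) + \<gamma> * real d", OF a])
    show "finite \<I>" by (rule finite_subset[of _ "Pow {..<d}"]) (auto simp: \<I>_def)
    show "h w + \<phi> w \<le> f I w" if "I \<in> \<I>" "w \<in> carrier_vec d" for I w
      using that mult_left_mono[OF trimmed_l1_le[of w d I K] \<gamma>] by (auto simp: f_def \<phi> \<I>_def)
    show "\<exists>I\<in>\<I>. h w + \<phi> w = f I w" if w: "w \<in> carrier_vec d" for w
    proof -
      obtain I where "I \<subseteq> {..<d}" "card I = d - K" "trimmed_l1 K w = (\<Sum>i\<in>I. \<bar>w $ i\<bar>)"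
        using trimmed_l1_attained[OF w] by metis
      then show ?thesis by (intro bexI[of _ I]) (auto simp: f_def \<phi> \<I>_def)
    qed
    show "f I a - (vnorm (gradient d h a) + \<gamma> * real d) * vnorm (w - a) \<le> f I w"
      if "I \<in> \<I>" and w: "w \<in> carrier_vec d" for I w
    proof -
      have "I \<subseteq> {..<d}" using \<open>I \<in> \<I>\<close> by (simp add: \<I>_def)
      then show ?thesis
        using mult_left_mono[OF sum_abs_lipschitz[OF a w, of I] \<gamma>] subgradient[OF a w]
          abs_scalar_prod_le_vnorm[OF gradient_carrier[of a], of "w - a"] a w
        by (simp add: f_def algebra_simps abs_le_iff)
    qed
    show "f I (a + s \<cdot>\<^sub>v (w - a)) \<le> (1 - s) * f I a + s * f I w"
      if I: "I \<in> \<I>" and w: "w \<in> carrier_vec d" and s: "0 < s" "s < 1" for I w s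
    proof -
      have "(\<Sum>i\<in>I. \<bar>(a + s \<cdot>\<^sub>v (w - a)) $ i\<bar>) \<le> (\<Sum>i\<in>I. (1 - s) * \<bar>a $ i\<bar> + s * \<bar>w $ i\<bar>)"
      proof (rule sum_mono)
        fix i assume "i \<in> I"
        then have "(a + s \<cdot>\<^sub>v (w - a)) $ i = (1 - s) * a $ i + s * w $ i"
          using I a w by (auto simp: \<I>_def algebra_simps)
        also have "\<bar>\<dots>\<bar> \<le> \<bar>(1 - s) * a $ i\<bar> + \<bar>s * w $ i\<bar>" by (rule abs_triangle_ineq)
        finally show "\<bar>(a + s \<cdot>\<^sub>v (w - a)) $ i\<bar> \<le> (1 - s) * \<bar>a $ i\<bar> + s * \<bar>w $ i\<bar>"
          using s by (simp add: abs_mult)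
      qed
      also have "\<dots> = (1 - s) * (\<Sum>i\<in>I. \<bar>a $ i\<bar>) + s * (\<Sum>i\<in>I. \<bar>w $ i\<bar>)"
        by (simp add: sum.distrib sum_distrib_left)
      finally have "\<gamma> * (\<Sum>i\<in>I. \<bar>(a + s \<cdot>\<^sub>v (w - a)) $ i\<bar>)
          \<le> \<gamma> * ((1 - s) * (\<Sum>i\<in>I. \<bar>a $ i\<bar>) + s * (\<Sum>i\<in>I. \<bar>w $ i\<bar>))"
        using \<gamma> by (rule mult_left_mono)
      then show ?thesis
        using h_convex[OF a w, of s] s by (simp add: f_def algebra_simps)
    qed
  qed (use E in auto)
qed

end

section \<open>Regularized least squares\<close>

lemma least_squares_expansion:
  assumes A: "A \<in> carrier_mat n d" and z: "z \<in> carrier_vec n"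
    and b: "b \<in> carrier_vec d" and w: "w \<in> carrier_vec d"
  shows "(vnorm (z - A *\<^sub>v w))\<^sup>2 =
    (vnorm (z - A *\<^sub>v b))\<^sup>2 - 2 * ((A\<^sup>T *\<^sub>v (z - A *\<^sub>v b)) \<bullet> (w - b)) + (vnorm (A *\<^sub>v (w - b)))\<^sup>2"
proof -
  let ?u = "z - A *\<^sub>v b" and ?v = "A *\<^sub>v (w - b)"
  have u: "?u \<in> carrier_vec n" and v: "?v \<in> carrier_vec n" using A z b w by auto
  have "z - A *\<^sub>v w = ?u - ?v"
    using A z b w by (intro eq_vecI) (auto simp: mult_minus_distrib_mat_vec[OF A w b])
  moreover have "(?u - ?v) \<bullet> (?u - ?v) = ?u \<bullet> ?u - 2 * (?u \<bullet> ?v) + ?v \<bullet> ?v"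
    using u v by (simp add: minus_scalar_prod_distrib[of _ n] scalar_prod_minus_distrib[of _ n]
        comm_scalar_prod[of ?v n ?u])
  moreover have "(A\<^sup>T *\<^sub>v ?u) \<bullet> (w - b) = ?u \<bullet> ?v"
    using transpose_vec_mult_scalar[OF A _ u, of "w - b"] w b by simp
  ultimately show ?thesis by (simp add: vnorm_power2)
qed

text \<open>The gradient is defined by unique partial derivatives; an exact second-order expansion
  identifies all of them at once.\<close>

lemma gradient_of_quadratic_expansion:
  assumes b: "b \<in> carrier_vec d" and G: "G \<in> carrier_vec d"
    and expansion: "\<And>w. w \<in> carrier_vec d \<Longrightarrow> h w = h b + G \<bullet> (w - b) + Q (w - b)"
    and Q: "\<And>s v. v \<in> carrier_vec d \<Longrightarrow> Q (s \<cdot>\<^sub>v v) = s\<^sup>2 * Q v"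
  shows "gradient d h b = G"
proof (rule eq_vecI)
  fix i assume "i < dim_vec G"
  then have i: "i < d" using G by simp
  have "h (b + s \<cdot>\<^sub>v unit_vec d i) = h b + s * G $ i + s\<^sup>2 * Q (unit_vec d i)" for s
  proof -
    have "b + s \<cdot>\<^sub>v unit_vec d i - b = s \<cdot>\<^sub>v unit_vec d i" using b by (intro eq_vecI) auto
    then show ?thesis
      using expansion[of "b + s \<cdot>\<^sub>v unit_vec d i"] Q[of "unit_vec d i" s] b G i by simp
  qed
  moreover have "((\<lambda>s. h b + s * G $ i + s\<^sup>2 * Q (unit_vec d i)) has_real_derivative G $ i) (at 0)"
    by (auto intro!: derivative_eq_intros)
  ultimately have "((\<lambda>s. h (b + s \<cdot>\<^sub>v unit_vec d i)) has_real_derivative G $ i) (at 0)" by simp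
  then show "gradient d h b $ i = G $ i"
    using i by (auto simp: gradient_def intro!: the_equality dest: DERIV_unique)
qed (use G in \<open>simp add: gradient_def\<close>)

lemma regularized_least_squares_smooth_convex:
  assumes L1: "L1 \<in> carrier_mat n d" and L2: "L2 \<in> carrier_mat r d"
    and z1: "z1 \<in> carrier_vec n" and z2: "z2 \<in> carrier_vec r" and c: "0 \<le> c"
    and h: "h = (\<lambda>b. 1/2 * (vnorm (z1 - L1 *\<^sub>v b))\<^sup>2 + c/2 * (vnorm (z2 - L2 *\<^sub>v b))\<^sup>2)"
    and \<phi>: "\<And>b. b \<in> carrier_vec d \<Longrightarrow> 0 \<le> \<phi> b"
  obtains L where "smooth_convex_composite d h \<phi> L"
proof -
  define G where "G b = (- 1) \<cdot>\<^sub>v (L1\<^sup>T *\<^sub>v (z1 - L1 *\<^sub>v b)) + (- c) \<cdot>\<^sub>v (L2\<^sup>T *\<^sub>v (z2 - L2 *\<^sub>v b))" for b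
  define Q where "Q v = 1/2 * (vnorm (L1 *\<^sub>v v))\<^sup>2 + c/2 * (vnorm (L2 *\<^sub>v v))\<^sup>2" for v
  have T: "L1\<^sup>T *\<^sub>v (z1 - L1 *\<^sub>v b) \<in> carrier_vec d" "L2\<^sup>T *\<^sub>v (z2 - L2 *\<^sub>v b) \<in> carrier_vec d" for b
    using L1 L2 by (auto intro!: carrier_vecI)
  have G: "G b \<in> carrier_vec d" for b using T[of b] by (simp add: G_def)
  have expansion: "h w = h b + G b \<bullet> (w - b) + Q (w - b)"
    if "b \<in> carrier_vec d" "w \<in> carrier_vec d" for b w
  proof -
    have "G b \<bullet> (w - b) = - ((L1\<^sup>T *\<^sub>v (z1 - L1 *\<^sub>v b)) \<bullet> (w - b))
        - c * ((L2\<^sup>T *\<^sub>v (z2 - L2 *\<^sub>v b)) \<bullet> (w - b))"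
      using that T[of b] by (simp add: G_def add_scalar_prod_distrib[of _ d])
    moreover have "1/2 * (x - 2 * p + q) + c/2 * (x' - 2 * p' + q')
        = 1/2 * x + c/2 * x' + (- p - c * p') + (1/2 * q + c/2 * q')" for x p q x' p' q' :: real
      by (simp add: field_simps)
    ultimately show ?thesis
      unfolding h least_squares_expansion[OF L1 z1 that] least_squares_expansion[OF L2 z2 that] Q_def
      by simp
  qed
  have Q_smult: "Q (s \<cdot>\<^sub>v v) = s\<^sup>2 * Q v" if "v \<in> carrier_vec d" for s v
  proof -
    have L1v: "L1 *\<^sub>v v \<in> carrier_vec n" and L2v: "L2 *\<^sub>v v \<in> carrier_vec r"
      using that L1 L2 by auto
    show ?thesis
      unfolding Q_def mult_mat_vec[OF L1 that] mult_mat_vec[OF L2 that]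
        vnorm_smult_power2[OF L1v] vnorm_smult_power2[OF L2v]
      by (simp add: distrib_left)
  qed
  have gradient: "gradient d h b = G b" if "b \<in> carrier_vec d" for b
    by (rule gradient_of_quadratic_expansion[OF that G expansion[OF that] Q_smult])
  have Q_nonneg: "0 \<le> Q v" for v using c by (simp add: Q_def)
  obtain C1 where C1: "0 \<le> C1" "\<And>v. v \<in> carrier_vec d \<Longrightarrow> vnorm (L1 *\<^sub>v v) \<le> C1 * vnorm v"
    using mult_mat_vec_bounded[of L1] L1 by auto
  obtain C2 where C2: "0 \<le> C2" "\<And>v. v \<in> carrier_vec d \<Longrightarrow> vnorm (L2 *\<^sub>v v) \<le> C2 * vnorm v"
    using mult_mat_vec_bounded[of L2] L2 by auto
  \<comment> \<open>The summand 1 keeps \<open>L\<close> positive if both matrices vanish.\<close>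
  define L where "L = C1\<^sup>2 + c * C2\<^sup>2 + 1"
  have L: "0 < L" using c by (auto simp: L_def intro!: add_nonneg_pos)
  have Q_le: "Q v \<le> L / 2 * (vnorm v)\<^sup>2" if "v \<in> carrier_vec d" for v
  proof -
    have "(vnorm (L1 *\<^sub>v v))\<^sup>2 \<le> (C1 * vnorm v)\<^sup>2" "(vnorm (L2 *\<^sub>v v))\<^sup>2 \<le> (C2 * vnorm v)\<^sup>2"
      using C1(2) C2(2) that by (auto intro!: power_mono)
    then have "Q v \<le> 1/2 * (C1 * vnorm v)\<^sup>2 + c/2 * (C2 * vnorm v)\<^sup>2"
      unfolding Q_def using c by (intro add_mono mult_left_mono) auto
    also have "\<dots> \<le> L / 2 * (vnorm v)\<^sup>2"
      by (simp add: L_def power_mult_distrib field_simps)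
    finally show ?thesis .
  qed
  have "smooth_convex_composite d h \<phi> L"
  proof
    show "0 \<le> h b" for b using c by (simp add: h)
    show "h b + gradient d h b \<bullet> (w - b) \<le> h w"
      and "h w \<le> h b + gradient d h b \<bullet> (w - b) + L / 2 * (vnorm (w - b))\<^sup>2"
      if "b \<in> carrier_vec d" "w \<in> carrier_vec d" for b w
      using expansion[OF that] gradient[OF that(1)] Q_nonneg[of "w - b"] Q_le[of "w - b"] that
      by auto
  qed (use L \<phi> in auto)
  then show ?thesis by (rule that)
qed

lemma smult_mat_mult_mat_vec:
  fixes A :: "real mat"
  assumes "A \<in> carrier_mat n k" "v \<in> carrier_vec k"
  shows "(c \<cdot>\<^sub>m A) *\<^sub>v v = c \<cdot>\<^sub>v (A *\<^sub>v v)"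
  using assms by (intro eq_vecI) auto

lemma normal_equations_minimize:
  assumes P: "P \<in> carrier_mat n k" and Q: "Q \<in> carrier_mat r k"
    and u: "u \<in> carrier_vec n" and v: "v \<in> carrier_vec r" and c: "0 \<le> c"
    and \<xi>: "\<xi> \<in> carrier_vec k" and \<zeta>: "\<zeta> \<in> carrier_vec k"
    and normal: "(P\<^sup>T * P + c \<cdot>\<^sub>m (Q\<^sup>T * Q)) *\<^sub>v \<xi> = P\<^sup>T *\<^sub>v u + c \<cdot>\<^sub>v (Q\<^sup>T *\<^sub>v v)"
  shows "1/2 * (vnorm (u - P *\<^sub>v \<xi>))\<^sup>2 + c/2 * (vnorm (v - Q *\<^sub>v \<xi>))\<^sup>2
       \<le> 1/2 * (vnorm (u - P *\<^sub>v \<zeta>))\<^sup>2 + c/2 * (vnorm (v - Q *\<^sub>v \<zeta>))\<^sup>2"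
proof -
  let ?p = "P\<^sup>T *\<^sub>v (u - P *\<^sub>v \<xi>)" and ?q = "Q\<^sup>T *\<^sub>v (v - Q *\<^sub>v \<xi>)"
  have p: "?p \<in> carrier_vec k" and q: "?q \<in> carrier_vec k" using P Q by (auto intro!: carrier_vecI)
  have "?p = P\<^sup>T *\<^sub>v u - (P\<^sup>T * P) *\<^sub>v \<xi>"
    using P u \<xi> by (simp add: mult_minus_distrib_mat_vec[of _ k n] assoc_mult_mat_vec[of _ k n _ k])
  moreover have "?q = Q\<^sup>T *\<^sub>v v - (Q\<^sup>T * Q) *\<^sub>v \<xi>"
    using Q v \<xi> by (simp add: mult_minus_distrib_mat_vec[of _ k r] assoc_mult_mat_vec[of _ k r _ k])
  moreover have "(P\<^sup>T * P) *\<^sub>v \<xi> + c \<cdot>\<^sub>v ((Q\<^sup>T * Q) *\<^sub>v \<xi>) = P\<^sup>T *\<^sub>v u + c \<cdot>\<^sub>v (Q\<^sup>T *\<^sub>v v)"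
    using normal P Q \<xi> by (simp add: add_mult_distrib_mat_vec[of _ k k] smult_mat_mult_mat_vec[of _ k k])
  ultimately have "?p + c \<cdot>\<^sub>v ?q = 0\<^sub>v k"
    using P Q u v \<xi> by (auto simp: vec_eq_iff algebra_simps)
  then have "(?p + c \<cdot>\<^sub>v ?q) \<bullet> (\<zeta> - \<xi>) = 0" using \<xi> \<zeta> by simp
  then have "?p \<bullet> (\<zeta> - \<xi>) + c * (?q \<bullet> (\<zeta> - \<xi>)) = 0"
    using p q \<xi> \<zeta> by (simp add: add_scalar_prod_distrib[of _ k])
  moreover have "1/2 * (s - 2 * p' + q') + c/2 * (t - 2 * p'' + q'')
      = 1/2 * s + c/2 * t - (p' + c * p'') + (1/2 * q' + c/2 * q'')" for s t p' p'' q' q'' :: real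
    by (simp add: field_simps)
  moreover have "0 \<le> 1/2 * (vnorm (P *\<^sub>v (\<zeta> - \<xi>)))\<^sup>2 + c/2 * (vnorm (Q *\<^sub>v (\<zeta> - \<xi>)))\<^sup>2" using c by simp
  ultimately show ?thesis
    unfolding least_squares_expansion[OF P u \<xi> \<zeta>] least_squares_expansion[OF Q v \<xi> \<zeta>]
    by simp
qed

section \<open>Invertible matrices\<close>

lemma mat_inv_of_injective:
  assumes A: "A \<in> carrier_mat n n"
    and inj: "\<And>v. v \<in> carrier_vec n \<Longrightarrow> A *\<^sub>v v = 0\<^sub>v n \<Longrightarrow> v = 0\<^sub>v n"
  shows "mat_inv A \<in> carrier_mat n n" "A * mat_inv A = 1\<^sub>m n" "mat_inv A * A = 1\<^sub>m n"
proof -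
  have "det A \<noteq> 0" using det_0_iff_vec_prod_zero[OF A] inj by blast
  then have "A \<in> Units (ring_mat TYPE(real) n ())" by (rule det_non_zero_imp_unit[OF A])
  then obtain B where B: "mat_inverse A = Some B" using mat_inverse(1)[OF A] by fastforce
  then show "mat_inv A \<in> carrier_mat n n" "A * mat_inv A = 1\<^sub>m n" "mat_inv A * A = 1\<^sub>m n"
    using mat_inverse(2)[OF A B] by (auto simp: mat_inv_def)
qed

lemma mat_inv_of_invertible:
  assumes A: "A \<in> carrier_mat n n" and inv: "invertible_mat A"
  shows "mat_inv A \<in> carrier_mat n n" "A * mat_inv A = 1\<^sub>m n" "mat_inv A * A = 1\<^sub>m n"
proof -
  obtain B where "inverts_mat B A" "inverts_mat A B" using inv by (auto simp: invertible_mat_def)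
  then have BA: "B * A = 1\<^sub>m (dim_row B)" and AB: "A * B = 1\<^sub>m n" using A by (auto simp: inverts_mat_def)
  have "dim_col B = n" using arg_cong[OF AB, of dim_col] by simp
  moreover have "dim_row B = n" using arg_cong[OF BA, of dim_col] A by simp
  ultimately have B: "B \<in> carrier_mat n n" by auto
  have "v = 0\<^sub>v n" if "v \<in> carrier_vec n" "A *\<^sub>v v = 0\<^sub>v n" for v
  proof -
    have "v = (B * A) *\<^sub>v v" using BA B that by simp
    also have "\<dots> = B *\<^sub>v (A *\<^sub>v v)" using A B that by (intro assoc_mult_mat_vec) auto
    also have "\<dots> = 0\<^sub>v n" unfolding that(2) using B by (intro eq_vecI) auto
    finally show ?thesis .
  qed
  then show "mat_inv A \<in> carrier_mat n n" "A * mat_inv A = 1\<^sub>m n" "mat_inv A * A = 1\<^sub>m n"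
    using mat_inv_of_injective[OF A] by blast+
qed

lemma full_column_rank_injective:
  fixes A :: "real mat"
  assumes A: "A \<in> carrier_mat n k" and rank: "vec_space.rank n A = k"
    and v: "v \<in> carrier_vec k" "A *\<^sub>v v = 0\<^sub>v n"
  shows "v = 0\<^sub>v k"
proof (rule ccontr)
  interpret vec_space "TYPE(real)" n .
  assume "v \<noteq> 0\<^sub>v k"
  show False
  proof (cases "distinct (cols A)")
    case True
    then show False
      using full_rank_lin_indpt[OF A rank] lin_depI[OF A v(1) \<open>v \<noteq> 0\<^sub>v k\<close> v(2)] by blast
  next
    case False
    let ?indep = "\<lambda>T. T \<subseteq> set (cols A) \<and> lin_indpt T"
    obtain T where T: "maximal T ?indep"
      using maximal_exists[of ?indep "card (set (cols A))" "{}"]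
      by (meson List.finite_set card_mono empty_iff empty_subsetI finite_lin_indpt2 rev_finite_subset)
    then have "card T \<le> card (set (cols A))" by (simp add: card_mono maximal_def)
    also have "\<dots> < length (cols A)"
      using False card_distinct[of "cols A"] card_length[of "cols A"] by linarith
    finally show False using rank_card_indpt[OF A T] rank A by simp
  qed
qed

text \<open>If \<open>M v = 0\<close>, then \<open>0 = M v \<bullet> v = |P v|\<^sup>2 + c |Q v|\<^sup>2\<close>, so \<open>P v = 0\<close> and \<open>v = 0\<close> because \<open>P\<close>
  has full column rank.\<close>

lemma penalized_gram_mat_inv:
  assumes P: "P \<in> carrier_mat n k" and Q: "Q \<in> carrier_mat r k" and c: "0 \<le> c"
    and rank: "vec_space.rank n P = k"
  defines "M \<equiv> P\<^sup>T * P + c \<cdot>\<^sub>m (Q\<^sup>T * Q)"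
  shows "mat_inv M \<in> carrier_mat k k" "M * mat_inv M = 1\<^sub>m k"
proof -
  have M: "M \<in> carrier_mat k k" using P Q by (simp add: M_def)
  have "v = 0\<^sub>v k" if v: "v \<in> carrier_vec k" "M *\<^sub>v v = 0\<^sub>v k" for v
  proof -
    have Pv: "P *\<^sub>v v \<in> carrier_vec n" and Qv: "Q *\<^sub>v v \<in> carrier_vec r" using P Q v by auto
    have "M *\<^sub>v v = P\<^sup>T *\<^sub>v (P *\<^sub>v v) + c \<cdot>\<^sub>v (Q\<^sup>T *\<^sub>v (Q *\<^sub>v v))"
      using P Q v unfolding M_def
      by (simp add: add_mult_distrib_mat_vec[of _ k k] smult_mat_mult_mat_vec[of _ k k]
          assoc_mult_mat_vec[of _ k n _ k] assoc_mult_mat_vec[of _ k r _ k])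
    then have "(P\<^sup>T *\<^sub>v (P *\<^sub>v v) + c \<cdot>\<^sub>v (Q\<^sup>T *\<^sub>v (Q *\<^sub>v v))) \<bullet> v = 0\<^sub>v k \<bullet> v"
      by (simp only: v(2)[symmetric])
    then have "(P\<^sup>T *\<^sub>v (P *\<^sub>v v) + c \<cdot>\<^sub>v (Q\<^sup>T *\<^sub>v (Q *\<^sub>v v))) \<bullet> v = 0" using v(1) by simp
    moreover have "P\<^sup>T *\<^sub>v (P *\<^sub>v v) \<in> carrier_vec k" "Q\<^sup>T *\<^sub>v (Q *\<^sub>v v) \<in> carrier_vec k"
      using P Q by (auto intro!: carrier_vecI)
    ultimately have "(P\<^sup>T *\<^sub>v (P *\<^sub>v v)) \<bullet> v + c * ((Q\<^sup>T *\<^sub>v (Q *\<^sub>v v)) \<bullet> v) = 0"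
      using v(1) by (simp add: add_scalar_prod_distrib[of _ k])
    then have "(vnorm (P *\<^sub>v v))\<^sup>2 + c * (vnorm (Q *\<^sub>v v))\<^sup>2 = 0"
      by (simp only: transpose_vec_mult_scalar[OF P v(1) Pv] transpose_vec_mult_scalar[OF Q v(1) Qv]
          vnorm_power2)
    then have "(vnorm (P *\<^sub>v v))\<^sup>2 = 0" using c by (simp add: add_nonneg_eq_0_iff)
    then have "P *\<^sub>v v = 0\<^sub>v n" using vnorm_eq_0_iff[OF Pv] by simp
    then show ?thesis using full_column_rank_injective[OF P rank v(1)] by blast
  qed
  then show "mat_inv M \<in> carrier_mat k k" "M * mat_inv M = 1\<^sub>m k"
    using mat_inv_of_injective[OF M] by blast+
qed

lemma take_drop_cols_mult_append:
  assumes S: "S \<in> carrier_mat n (d + k)" and b: "b \<in> carrier_vec d" and v: "v \<in> carrier_vec k"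
  shows "S *\<^sub>v (b @\<^sub>v v) = take_cols d S *\<^sub>v b + drop_cols d S *\<^sub>v v"
proof (rule eq_vecI)
  fix i assume "i < dim_vec (take_cols d S *\<^sub>v b + drop_cols d S *\<^sub>v v)"
  then have i: "i < n" using S by (simp add: drop_cols_def)
  have "row S i = row (take_cols d S) i @\<^sub>v row (drop_cols d S) i"
    using S i by (intro eq_vecI) (auto simp: take_cols_def drop_cols_def)
  then have "(S *\<^sub>v (b @\<^sub>v v)) $ i
      = (row (take_cols d S) i @\<^sub>v row (drop_cols d S) i) \<bullet> (b @\<^sub>v v)"
    using S i by simp
  also have "\<dots> = row (take_cols d S) i \<bullet> b + row (drop_cols d S) i \<bullet> v"
    using S i b v by (intro scalar_prod_append) (auto simp: take_cols_def drop_cols_def)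
  finally show "(S *\<^sub>v (b @\<^sub>v v)) $ i = (take_cols d S *\<^sub>v b + drop_cols d S *\<^sub>v v) $ i"
    using S i by (simp add: take_cols_def drop_cols_def)
qed (use S in \<open>simp add: drop_cols_def\<close>)

section \<open>Partial minimization and the change of variables\<close>

lemma diff_mat_carrier: "m < N \<Longrightarrow> diff_mat N m \<in> carrier_mat (N - m) N"
proof (induction m)
  case (Suc m)
  then have "first_diff_mat (N - Suc m) \<in> carrier_mat (N - Suc m) (N - m)"
    by (simp add: first_diff_mat_def Suc_diff_Suc)
  then show ?case using Suc by auto
qed simp

lemma scaled_diff_mat_carrier:
  assumes "1 \<le> l"
  shows "scaled_diff_mat t l q \<in> carrier_mat (l - 1) (l + q)"
proof (induction q)
  case 0
  then show ?case using assms by (simp add: first_diff_mat_def)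
next
  case (Suc q)
  have "Delta_mat t l (Suc q) \<in> carrier_mat (l + q) (l + Suc q)"
    using assms by (simp add: Delta_mat_def)
  then show ?case using Suc by auto
qed

text \<open>If \<open>F\<close> is the partial minimum of \<open>f\<close> over the fibres of \<open>T\<close> and \<open>a\<close> attains it in its own fibre,
  then local minimality of \<open>T a\<close> lifts to \<open>a\<close>, because \<open>T\<close> maps a neighbourhood of \<open>a\<close> into any
  given neighbourhood of \<open>T a\<close>.\<close>

lemma is_local_min_transfer:
  assumes T: "T \<in> carrier_mat d N" and a: "a \<in> carrier_vec N"
    and min: "is_local_min d F (T *\<^sub>v a)"
    and le: "\<And>w. w \<in> carrier_vec N \<Longrightarrow> F (T *\<^sub>v w) \<le> f w" and eq: "f a = F (T *\<^sub>v a)"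
  shows "is_local_min N f a"
proof -
  obtain \<epsilon> where \<epsilon>: "0 < \<epsilon>"
    and F: "\<And>w. w \<in> carrier_vec d \<Longrightarrow> vnorm (w - T *\<^sub>v a) < \<epsilon> \<Longrightarrow> F (T *\<^sub>v a) \<le> F w"
    using min unfolding is_local_min_def by blast
  obtain C where C: "0 \<le> C" "\<And>v. v \<in> carrier_vec N \<Longrightarrow> vnorm (T *\<^sub>v v) \<le> C * vnorm v"
    using mult_mat_vec_bounded[of T] T by auto
  have "f a \<le> f w" if w: "w \<in> carrier_vec N" "vnorm (w - a) < \<epsilon> / (C + 1)" for w
  proof -
    have "vnorm (T *\<^sub>v w - T *\<^sub>v a) \<le> C * vnorm (w - a)"
      using C(2)[of "w - a"] w a by (simp add: mult_minus_distrib_mat_vec[OF T])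
    also have "\<dots> \<le> (C + 1) * vnorm (w - a)" by (intro mult_right_mono) auto
    also have "\<dots> < \<epsilon>" using w(2) C(1) by (simp add: field_simps)
    finally have "F (T *\<^sub>v a) \<le> F (T *\<^sub>v w)" using T w by (intro F) auto
    then show ?thesis using le[OF w(1)] eq by simp
  qed
  moreover have "0 < \<epsilon> / (C + 1)" using \<epsilon> C(1) by simp
  ultimately show ?thesis using a unfolding is_local_min_def by blast
qed

lemma is_accumulation_point_mult_mat_vec:
  assumes T: "T \<in> carrier_mat d N" and X: "\<And>k. X k \<in> carrier_vec N"
    and acc: "is_accumulation_point N X a"
  shows "is_accumulation_point d (\<lambda>k. T *\<^sub>v X k) (T *\<^sub>v a)"
proof -
  obtain r where a: "a \<in> carrier_vec N" and r: "strict_mono r"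
    and lim: "(\<lambda>k. vnorm (X (r k) - a)) \<longlonglongrightarrow> 0"
    using acc unfolding is_accumulation_point_def by blast
  obtain C where C: "0 \<le> C" "\<And>v. v \<in> carrier_vec N \<Longrightarrow> vnorm (T *\<^sub>v v) \<le> C * vnorm v"
    using mult_mat_vec_bounded[of T] T by auto
  have "vnorm (T *\<^sub>v X (r k) - T *\<^sub>v a) \<le> vnorm (X (r k) - a) * C" for k
    using C(2)[of "X (r k) - a"] a X[of "r k"]
    by (simp add: mult_minus_distrib_mat_vec[OF T] mult.commute)
  then have "(\<lambda>k. vnorm (T *\<^sub>v X (r k) - T *\<^sub>v a)) \<longlonglongrightarrow> 0"
    by (intro tendsto_0_le[where K = C, OF lim]) auto
  then show ?thesis using r T a unfolding is_accumulation_point_def by auto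
qed

text \<open>Combined with the preceding lemma: an affine equation that holds along a sequence also holds
  at its accumulation points.\<close>

lemma is_accumulation_point_const:
  assumes v: "v \<in> carrier_vec d" and acc: "is_accumulation_point d (\<lambda>k. v) a"
  shows "a = v"
proof -
  have a: "a \<in> carrier_vec d" and "(\<lambda>k::nat. vnorm (v - a)) \<longlonglongrightarrow> 0"
    using acc unfolding is_accumulation_point_def by auto
  then have "vnorm (v - a) = 0" using LIMSEQ_unique tendsto_const by blast
  then have "v - a = 0\<^sub>v d" using vnorm_eq_0_iff[of "v - a" d] v a by simp
  then show ?thesis using v a by (auto simp: vec_eq_iff)
qed

text \<open>For fixed \<open>b\<close>, the regularized least squares objective in \<open>\<zeta>\<close> is minimized at
  \<open>\<xi> = H1 y - H2 b\<close>, since this solves its normal equations; the residuals at the minimum are the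
  affine functions \<open>z1 - L1 b\<close> and, up to sign, \<open>z2 - L2 b\<close>.\<close>

lemma partial_minimization:
  fixes P1 P2 Q1 Q2 :: "real mat"
  assumes P1: "P1 \<in> carrier_mat n d" and P2: "P2 \<in> carrier_mat n k"
    and Q1: "Q1 \<in> carrier_mat r d" and Q2: "Q2 \<in> carrier_mat r k"
    and y: "y \<in> carrier_vec n" and c: "0 \<le> c" and rank: "vec_space.rank n P2 = k"
    and Minv: "Minv = mat_inv (P2\<^sup>T * P2 + c \<cdot>\<^sub>m (Q2\<^sup>T * Q2))"
    and H1: "H1 = Minv * P2\<^sup>T" and H2: "H2 = Minv * (P2\<^sup>T * P1 + c \<cdot>\<^sub>m (Q2\<^sup>T * Q1))"
    and z1: "z1 = y - (P2 * H1) *\<^sub>v y" and z2: "z2 = (Q2 * H1) *\<^sub>v y"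
    and L1: "L1 = P1 - P2 * H2" and L2: "L2 = Q2 * H2 - Q1"
    and b: "b \<in> carrier_vec d"
  shows "\<And>\<zeta>. \<zeta> \<in> carrier_vec k \<Longrightarrow>
       1/2 * (vnorm (z1 - L1 *\<^sub>v b))\<^sup>2 + c/2 * (vnorm (z2 - L2 *\<^sub>v b))\<^sup>2
     \<le> 1/2 * (vnorm (y - (P1 *\<^sub>v b + P2 *\<^sub>v \<zeta>)))\<^sup>2 + c/2 * (vnorm (Q1 *\<^sub>v b + Q2 *\<^sub>v \<zeta>))\<^sup>2"
    and "1/2 * (vnorm (z1 - L1 *\<^sub>v b))\<^sup>2 + c/2 * (vnorm (z2 - L2 *\<^sub>v b))\<^sup>2
     = 1/2 * (vnorm (y - (P1 *\<^sub>v b + P2 *\<^sub>v (H1 *\<^sub>v y - H2 *\<^sub>v b))))\<^sup>2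
       + c/2 * (vnorm (Q1 *\<^sub>v b + Q2 *\<^sub>v (H1 *\<^sub>v y - H2 *\<^sub>v b)))\<^sup>2"
proof -
  define M where "M = P2\<^sup>T * P2 + c \<cdot>\<^sub>m (Q2\<^sup>T * Q2)"
  have M: "M \<in> carrier_mat k k" using P2 Q2 by (simp add: M_def)
  have Mi: "Minv \<in> carrier_mat k k" "M * Minv = 1\<^sub>m k"
    using penalized_gram_mat_inv[OF P2 Q2 c rank] by (simp_all add: Minv M_def)
  define N where "N = P2\<^sup>T * P1 + c \<cdot>\<^sub>m (Q2\<^sup>T * Q1)"
  have N: "N \<in> carrier_mat k d" using P1 P2 Q1 Q2 by (simp add: N_def)
  have H2_N: "H2 = Minv * N" by (simp add: H2 N_def)
  have H1c: "H1 \<in> carrier_mat k n" and H2c: "H2 \<in> carrier_mat k d"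
    using Mi P2 N by (simp_all add: H1 H2_N)
  define u v where "u = y - P1 *\<^sub>v b" and "v = - (Q1 *\<^sub>v b)"
  have uc: "u \<in> carrier_vec n" and vc: "v \<in> carrier_vec r"
    using y P1 Q1 b by (simp_all add: u_def v_def)
  have residual: "y - (P1 *\<^sub>v b + P2 *\<^sub>v \<zeta>) = u - P2 *\<^sub>v \<zeta>"
    "vnorm (Q1 *\<^sub>v b + Q2 *\<^sub>v \<zeta>) = vnorm (v - Q2 *\<^sub>v \<zeta>)" if "\<zeta> \<in> carrier_vec k" for \<zeta>
  proof -
    have Q: "Q1 *\<^sub>v b \<in> carrier_vec r" "Q2 *\<^sub>v \<zeta> \<in> carrier_vec r" using Q1 Q2 b that by auto
    show "y - (P1 *\<^sub>v b + P2 *\<^sub>v \<zeta>) = u - P2 *\<^sub>v \<zeta>"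
      using P1 P2 y b that by (intro eq_vecI) (auto simp: u_def)
    have "v - Q2 *\<^sub>v \<zeta> = 0\<^sub>v r - (Q1 *\<^sub>v b + Q2 *\<^sub>v \<zeta>)" "Q1 *\<^sub>v b + Q2 *\<^sub>v \<zeta> = (Q1 *\<^sub>v b + Q2 *\<^sub>v \<zeta>) - 0\<^sub>v r"
      using Q Q1 Q2 by (auto simp: v_def intro!: eq_vecI)
    then show "vnorm (Q1 *\<^sub>v b + Q2 *\<^sub>v \<zeta>) = vnorm (v - Q2 *\<^sub>v \<zeta>)"
      using vnorm_minus_commute[of "0\<^sub>v r" r "Q1 *\<^sub>v b + Q2 *\<^sub>v \<zeta>"] Q by simp
  qed
  define \<xi> where "\<xi> = H1 *\<^sub>v y - H2 *\<^sub>v b"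
  have \<xi>: "\<xi> \<in> carrier_vec k" using H1c H2c y b by (simp add: \<xi>_def)
  have P2y: "P2\<^sup>T *\<^sub>v y \<in> carrier_vec k" and Nb: "N *\<^sub>v b \<in> carrier_vec k"
    using P2 y N b by (auto intro!: carrier_vecI)
  have \<xi>_eq: "\<xi> = Minv *\<^sub>v (P2\<^sup>T *\<^sub>v y - N *\<^sub>v b)"
    using Mi P2 y N b P2y Nb
    by (simp add: \<xi>_def H1 H2_N mult_minus_distrib_mat_vec[OF Mi(1)] assoc_mult_mat_vec[of _ k k]
        assoc_mult_mat_vec[of _ k k _ n])
  have "M *\<^sub>v \<xi> = (M * Minv) *\<^sub>v (P2\<^sup>T *\<^sub>v y - N *\<^sub>v b)"
    unfolding \<xi>_eq using M Mi P2y Nb by (intro assoc_mult_mat_vec[symmetric]) auto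
  also have "\<dots> = P2\<^sup>T *\<^sub>v y - N *\<^sub>v b" unfolding Mi(2) using P2y Nb by simp
  also have "\<dots> = P2\<^sup>T *\<^sub>v u + c \<cdot>\<^sub>v (Q2\<^sup>T *\<^sub>v v)"
  proof -
    have "P2\<^sup>T *\<^sub>v u = P2\<^sup>T *\<^sub>v y - P2\<^sup>T *\<^sub>v (P1 *\<^sub>v b)"
      unfolding u_def using P2 P1 y b by (intro mult_minus_distrib_mat_vec[of _ k n]) auto
    moreover have "Q2\<^sup>T *\<^sub>v v = - (Q2\<^sup>T *\<^sub>v (Q1 *\<^sub>v b))"
      unfolding v_def using Q2 Q1 b by (intro eq_vecI) auto
    moreover have "N *\<^sub>v b = P2\<^sup>T *\<^sub>v (P1 *\<^sub>v b) + c \<cdot>\<^sub>v (Q2\<^sup>T *\<^sub>v (Q1 *\<^sub>v b))"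
      unfolding N_def using P1 P2 Q1 Q2 b
      by (simp add: add_mult_distrib_mat_vec[of _ k d] smult_mat_mult_mat_vec[of _ k d]
          assoc_mult_mat_vec[of _ k n _ d] assoc_mult_mat_vec[of _ k r _ d])
    ultimately show ?thesis using P2 Q2 by (auto intro!: eq_vecI)
  qed
  finally have normal: "M *\<^sub>v \<xi> = P2\<^sup>T *\<^sub>v u + c \<cdot>\<^sub>v (Q2\<^sup>T *\<^sub>v v)" .
  have P2H: "P2 *\<^sub>v (H1 *\<^sub>v y) \<in> carrier_vec n" "P2 *\<^sub>v (H2 *\<^sub>v b) \<in> carrier_vec n" "P1 *\<^sub>v b \<in> carrier_vec n"
    and Q2H: "Q2 *\<^sub>v (H1 *\<^sub>v y) \<in> carrier_vec r" "Q2 *\<^sub>v (H2 *\<^sub>v b) \<in> carrier_vec r" "Q1 *\<^sub>v b \<in> carrier_vec r"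
    using P1 P2 Q1 Q2 H1c H2c y b by auto
  have z1_L1: "z1 - L1 *\<^sub>v b = u - P2 *\<^sub>v \<xi>"
  proof -
    have "P2 *\<^sub>v \<xi> = P2 *\<^sub>v (H1 *\<^sub>v y) - P2 *\<^sub>v (H2 *\<^sub>v b)"
      unfolding \<xi>_def using P2 H1c H2c y b by (intro mult_minus_distrib_mat_vec) auto
    moreover have "L1 *\<^sub>v b = P1 *\<^sub>v b - P2 *\<^sub>v (H2 *\<^sub>v b)"
      unfolding L1 using P1 P2 H2c b
      by (simp add: minus_mult_distrib_mat_vec[of _ n d] assoc_mult_mat_vec[of _ n k _ d])
    moreover have "z1 = y - P2 *\<^sub>v (H1 *\<^sub>v y)"
      unfolding z1 using P2 H1c y by (simp add: assoc_mult_mat_vec[of _ n k _ n])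
    ultimately show ?thesis using P2H P1 P2 y by (auto simp: u_def intro!: eq_vecI)
  qed
  have z2_L2: "z2 - L2 *\<^sub>v b = Q2 *\<^sub>v \<xi> - v"
  proof -
    have "Q2 *\<^sub>v \<xi> = Q2 *\<^sub>v (H1 *\<^sub>v y) - Q2 *\<^sub>v (H2 *\<^sub>v b)"
      unfolding \<xi>_def using Q2 H1c H2c y b by (intro mult_minus_distrib_mat_vec) auto
    moreover have "L2 *\<^sub>v b = Q2 *\<^sub>v (H2 *\<^sub>v b) - Q1 *\<^sub>v b"
      unfolding L2 using Q1 Q2 H2c b
      by (simp add: minus_mult_distrib_mat_vec[of _ r d] assoc_mult_mat_vec[of _ r k _ d])
    moreover have "z2 = Q2 *\<^sub>v (H1 *\<^sub>v y)"
      unfolding z2 using Q2 H1c y by (simp add: assoc_mult_mat_vec[of _ r k _ n])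
    ultimately show ?thesis using Q2H Q1 Q2 by (auto simp: v_def intro!: eq_vecI)
  qed
  have vnorm_z2: "vnorm (z2 - L2 *\<^sub>v b) = vnorm (v - Q2 *\<^sub>v \<xi>)"
    unfolding z2_L2 using Q2 \<xi> vc by (intro vnorm_minus_commute) auto
  show "1/2 * (vnorm (z1 - L1 *\<^sub>v b))\<^sup>2 + c/2 * (vnorm (z2 - L2 *\<^sub>v b))\<^sup>2
     \<le> 1/2 * (vnorm (y - (P1 *\<^sub>v b + P2 *\<^sub>v \<zeta>)))\<^sup>2 + c/2 * (vnorm (Q1 *\<^sub>v b + Q2 *\<^sub>v \<zeta>))\<^sup>2"
    if "\<zeta> \<in> carrier_vec k" for \<zeta>
    unfolding z1_L1 vnorm_z2 residual[OF that]
    by (rule normal_equations_minimize[OF P2 Q2 uc vc c \<xi> that normal[unfolded M_def]])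
  show "1/2 * (vnorm (z1 - L1 *\<^sub>v b))\<^sup>2 + c/2 * (vnorm (z2 - L2 *\<^sub>v b))\<^sup>2
     = 1/2 * (vnorm (y - (P1 *\<^sub>v b + P2 *\<^sub>v (H1 *\<^sub>v y - H2 *\<^sub>v b))))\<^sup>2
       + c/2 * (vnorm (Q1 *\<^sub>v b + Q2 *\<^sub>v (H1 *\<^sub>v y - H2 *\<^sub>v b)))\<^sup>2"
    unfolding z1_L1 vnorm_z2 \<xi>_def[symmetric] residual[OF \<xi>] by (rule refl)
qed

section \<open>GIST for trend filtering with the trimmed penalty\<close>

theorem theorem3p2:
  fixes p l n m K mem :: nat
    and t :: "int \<Rightarrow> real"
    and x y z1 z2 :: "real vec"
    and c \<gamma> \<rho> \<eta>lo \<eta>hi \<sigma> :: real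
    and B D Ds A S S1 S2 Minv H1 H2 L1 L2 :: "real mat"
    and g :: "real vec \<Rightarrow> real vec"
    and h F :: "real vec \<Rightarrow> real"
    and \<beta> :: "nat \<Rightarrow> real vec"
  assumes "l \<ge> 2" and "n \<ge> 1"
    and knots: "strict_mono_on {- int p..int l + int p} t"
    and "x \<in> carrier_vec n" and "y \<in> carrier_vec n"
    and "\<And>i. i < n \<Longrightarrow> x $ i \<in> {t 0..<t (int l)}"
    and "c \<ge> 0" and "\<gamma> > 0" and "K \<in> {0..l - 1}"
    and "1 \<le> m" and "m \<le> l + p - 1"
    and B: "B = bspline_mat t l p x"
    and D: "D = diff_mat (l + p) m"
    and Ds: "Ds = scaled_diff_mat t l p"
    and "A \<in> carrier_mat (p + 1) (l + p)"
    and "invertible_mat (Ds @\<^sub>r A)"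
    and S: "S = mat_inv (Ds @\<^sub>r A)"
    and S1: "S1 = take_cols (l - 1) S"
    and S2: "S2 = drop_cols (l - 1) S"
    and full_rank: "vec_space.rank n (B * S2) = p + 1"
    and Minv: "Minv = mat_inv ((B * S2)\<^sup>T * (B * S2) + c \<cdot>\<^sub>m ((D * S2)\<^sup>T * (D * S2)))"
    and H1: "H1 = Minv * (B * S2)\<^sup>T"
    and H2: "H2 = Minv * ((B * S2)\<^sup>T * (B * S1) + c \<cdot>\<^sub>m ((D * S2)\<^sup>T * (D * S1)))"
    and z1: "z1 = y - (B * S2 * H1) *\<^sub>v y"
    and z2: "z2 = (D * S2 * H1) *\<^sub>v y"
    and L1: "L1 = B * S1 - B * S2 * H2"
    and L2: "L2 = D * S2 * H2 - D * S1"
    and g: "g = (\<lambda>b. H1 *\<^sub>v y - H2 *\<^sub>v b)"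
    and h: "h = (\<lambda>b. 1/2 * (vnorm (z1 - L1 *\<^sub>v b))\<^sup>2 + c/2 * (vnorm (z2 - L2 *\<^sub>v b))\<^sup>2)"
    and F: "F = (\<lambda>b. 1/2 * (vnorm (z1 - L1 *\<^sub>v b))\<^sup>2 + c/2 * (vnorm (z2 - L2 *\<^sub>v b))\<^sup>2
                      + \<gamma> * trimmed_l1 K b)"
    and "\<rho> > 1" and "0 < \<eta>lo" and "\<eta>lo \<le> \<eta>hi" and "0 < \<sigma>" and "\<sigma> < 1" and "mem \<ge> 1"
    and gist: "gist_sequence (l - 1) h (\<lambda>b. \<gamma> * trimmed_l1 K b) \<rho> \<eta>lo \<eta>hi \<sigma> mem \<beta>"
  shows "(\<forall>a. is_accumulation_point (l - 1) \<beta> a \<longrightarrow> is_local_min (l - 1) F a) \<and>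
         (\<forall>a. is_accumulation_point (l + p) (\<lambda>k. S *\<^sub>v (\<beta> k @\<^sub>v g (\<beta> k))) a \<longrightarrow>
              is_local_min (l + p)
                (\<lambda>\<alpha>. 1/2 * (vnorm (y - B *\<^sub>v \<alpha>))\<^sup>2 + c/2 * (vnorm (D *\<^sub>v \<alpha>))\<^sup>2
                      + \<gamma> * trimmed_l1 K (Ds *\<^sub>v \<alpha>)) a)"
proof -
  let ?d = "l - 1" and ?k = "p + 1" and ?N = "l + p" and ?r = "l + p - m"
  have N: "?d + ?k = ?N" using \<open>l \<ge> 2\<close> by simp
  have Bc: "B \<in> carrier_mat n ?N"
    using \<open>x \<in> carrier_vec n\<close> by (simp add: B bspline_mat_def)
  have Dc: "D \<in> carrier_mat ?r ?N"
    unfolding D using \<open>m \<le> l + p - 1\<close> \<open>l \<ge> 2\<close> by (intro diff_mat_carrier) auto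
  have Dsc: "Ds \<in> carrier_mat ?d ?N"
    unfolding Ds using \<open>l \<ge> 2\<close> by (intro scaled_diff_mat_carrier) auto
  have Ac: "A \<in> carrier_mat ?k ?N" by fact
  have "Ds @\<^sub>r A \<in> carrier_mat ?N ?N" using carrier_append_rows[OF Dsc Ac] N by simp
  from mat_inv_of_invertible[OF this \<open>invertible_mat (Ds @\<^sub>r A)\<close>]
  have Sc: "S \<in> carrier_mat ?N ?N" and DhS: "(Ds @\<^sub>r A) * S = 1\<^sub>m ?N" and SDh: "S * (Ds @\<^sub>r A) = 1\<^sub>m ?N"
    by (simp_all add: S)
  have Dhc: "Ds @\<^sub>r A \<in> carrier_mat ?N ?N" by fact
  have S1c: "S1 \<in> carrier_mat ?N ?d" using Sc by (simp add: S1 take_cols_def)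
  have S2c: "S2 \<in> carrier_mat ?N ?k" using Sc \<open>l \<ge> 2\<close> by (auto simp: S2 drop_cols_def)
  have yc: "y \<in> carrier_vec n" by fact
  have P1: "B * S1 \<in> carrier_mat n ?d" and P2: "B * S2 \<in> carrier_mat n ?k"
    and Q1: "D * S1 \<in> carrier_mat ?r ?d" and Q2: "D * S2 \<in> carrier_mat ?r ?k"
    using Bc Dc S1c S2c by auto
  note partial = partial_minimization[OF P1 P2 Q1 Q2 yc \<open>c \<ge> 0\<close> full_rank Minv H1 H2 z1 z2 L1 L2]
  have Minvc: "Minv \<in> carrier_mat ?k ?k"
    unfolding Minv by (rule penalized_gram_mat_inv(1)[OF P2 Q2 \<open>c \<ge> 0\<close> full_rank])
  have H1c: "H1 \<in> carrier_mat ?k n"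
    unfolding H1 using Minvc P2 by (intro mult_carrier_mat) auto
  have H2c: "H2 \<in> carrier_mat ?k ?d"
    unfolding H2 using Minvc P1 P2 Q1 Q2 by (intro mult_carrier_mat[of _ _ ?k] add_carrier_mat) auto
  have L1c: "L1 \<in> carrier_mat n ?d" and L2c: "L2 \<in> carrier_mat ?r ?d"
    unfolding L1 L2
    by (rule minus_carrier_mat[OF mult_carrier_mat[OF P2 H2c]], rule minus_carrier_mat[OF Q1])
  have z1c: "z1 \<in> carrier_vec n" and z2c: "z2 \<in> carrier_vec ?r"
    using yc P2 Q2 H1c by (auto simp: z1 z2 intro!: carrier_vecI)

  have F_eq: "F = (\<lambda>b. h b + \<gamma> * trimmed_l1 K b)" by (simp add: F h)
  obtain L where "smooth_convex_composite ?d h (\<lambda>b. \<gamma> * trimmed_l1 K b) L"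
    using regularized_least_squares_smooth_convex[OF L1c L2c z1c z2c \<open>c \<ge> 0\<close> h]
      trimmed_l1_nonneg \<open>\<gamma> > 0\<close> by (metis less_eq_real_def mult_nonneg_nonneg)
  then interpret smooth_convex_composite ?d h "\<lambda>b. \<gamma> * trimmed_l1 K b" L .
  have local_min_F: "is_local_min ?d F a" if "is_accumulation_point ?d \<beta> a" for a
    unfolding F_eq
    using gist_trimmed_l1_local_min[OF refl _ gist \<open>\<rho> > 1\<close> \<open>0 < \<eta>lo\<close> \<open>\<eta>lo \<le> \<eta>hi\<close> \<open>0 < \<sigma>\<close>
        \<open>\<sigma> < 1\<close> \<open>mem \<ge> 1\<close> that] \<open>\<gamma> > 0\<close> by simp

  define f where "f \<alpha> = 1/2 * (vnorm (y - B *\<^sub>v \<alpha>))\<^sup>2 + c/2 * (vnorm (D *\<^sub>v \<alpha>))\<^sup>2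
                      + \<gamma> * trimmed_l1 K (Ds *\<^sub>v \<alpha>)" for \<alpha>
  have coords: "\<alpha> = S *\<^sub>v (Ds *\<^sub>v \<alpha> @\<^sub>v A *\<^sub>v \<alpha>)" if \<alpha>: "\<alpha> \<in> carrier_vec ?N" for \<alpha>
  proof -
    have "\<alpha> = (S * (Ds @\<^sub>r A)) *\<^sub>v \<alpha>" unfolding SDh using \<alpha> by simp
    also have "\<dots> = S *\<^sub>v ((Ds @\<^sub>r A) *\<^sub>v \<alpha>)" by (rule assoc_mult_mat_vec[OF Sc Dhc \<alpha>])
    finally show ?thesis by (simp only: mat_mult_append[OF Dsc Ac \<alpha>])
  qed
  have split: "B *\<^sub>v \<alpha> = B * S1 *\<^sub>v (Ds *\<^sub>v \<alpha>) + B * S2 *\<^sub>v (A *\<^sub>v \<alpha>)"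
    "D *\<^sub>v \<alpha> = D * S1 *\<^sub>v (Ds *\<^sub>v \<alpha>) + D * S2 *\<^sub>v (A *\<^sub>v \<alpha>)" if \<alpha>: "\<alpha> \<in> carrier_vec ?N" for \<alpha>
  proof -
    have Ds\<alpha>: "Ds *\<^sub>v \<alpha> \<in> carrier_vec ?d" and A\<alpha>: "A *\<^sub>v \<alpha> \<in> carrier_vec ?k"
      using Dsc Ac \<alpha> by auto
    have \<alpha>_eq: "\<alpha> = S1 *\<^sub>v (Ds *\<^sub>v \<alpha>) + S2 *\<^sub>v (A *\<^sub>v \<alpha>)"
      using coords[OF \<alpha>] take_drop_cols_mult_append[OF _ Ds\<alpha> A\<alpha>, of S ?N] Sc N by (simp add: S1 S2)
    have mult: "X *\<^sub>v \<alpha> = X * S1 *\<^sub>v (Ds *\<^sub>v \<alpha>) + X * S2 *\<^sub>v (A *\<^sub>v \<alpha>)"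
      if X: "X \<in> carrier_mat q ?N" for X :: "real mat" and q
    proof -
      have "X *\<^sub>v \<alpha> = X *\<^sub>v (S1 *\<^sub>v (Ds *\<^sub>v \<alpha>) + S2 *\<^sub>v (A *\<^sub>v \<alpha>))" using \<alpha>_eq by simp
      also have "\<dots> = X *\<^sub>v (S1 *\<^sub>v (Ds *\<^sub>v \<alpha>)) + X *\<^sub>v (S2 *\<^sub>v (A *\<^sub>v \<alpha>))"
        using X S1c S2c Ds\<alpha> A\<alpha> by (intro mult_add_distrib_mat_vec) auto
      finally show ?thesis
        using X S1c S2c Ds\<alpha> A\<alpha> by (simp add: assoc_mult_mat_vec[of _ q ?N])
    qed
    show "B *\<^sub>v \<alpha> = B * S1 *\<^sub>v (Ds *\<^sub>v \<alpha>) + B * S2 *\<^sub>v (A *\<^sub>v \<alpha>)" by (rule mult[OF Bc])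
    show "D *\<^sub>v \<alpha> = D * S1 *\<^sub>v (Ds *\<^sub>v \<alpha>) + D * S2 *\<^sub>v (A *\<^sub>v \<alpha>)" by (rule mult[OF Dc])
  qed
  have F_le_f: "F (Ds *\<^sub>v \<alpha>) \<le> f \<alpha>" if \<alpha>: "\<alpha> \<in> carrier_vec ?N" for \<alpha>
  proof -
    have "Ds *\<^sub>v \<alpha> \<in> carrier_vec ?d" "A *\<^sub>v \<alpha> \<in> carrier_vec ?k" using Dsc Ac \<alpha> by auto
    from partial(1)[OF this] show ?thesis by (simp add: F f_def split[OF \<alpha>])
  qed
  have F_eq_f: "f \<alpha> = F (Ds *\<^sub>v \<alpha>)"
    if \<alpha>: "\<alpha> \<in> carrier_vec ?N" and g\<alpha>: "A *\<^sub>v \<alpha> = g (Ds *\<^sub>v \<alpha>)" for \<alpha>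
  proof -
    have "Ds *\<^sub>v \<alpha> \<in> carrier_vec ?d" using Dsc \<alpha> by auto
    from partial(2)[OF this] show ?thesis
      by (simp add: F f_def split[OF \<alpha>] g\<alpha>[unfolded g])
  qed

  have \<beta>c: "\<beta> k \<in> carrier_vec ?d" for k using gist by (rule gist_sequence_carrier)
  have gc: "g (\<beta> k) \<in> carrier_vec ?k" for k using H1c H2c yc \<beta>c[of k] by (auto simp: g)
  define X where "X k = S *\<^sub>v (\<beta> k @\<^sub>v g (\<beta> k))" for k
  have X: "X k \<in> carrier_vec ?N" for k using Sc by (auto simp: X_def intro!: carrier_vecI)
  have X_coords: "Ds *\<^sub>v X k = \<beta> k" "A *\<^sub>v X k = g (\<beta> k)" for k
  proof -
    have bg: "\<beta> k @\<^sub>v g (\<beta> k) \<in> carrier_vec ?N"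
      using append_carrier_vec[OF \<beta>c[of k] gc[of k]] N by simp
    have "(Ds *\<^sub>v X k) @\<^sub>v (A *\<^sub>v X k) = (Ds @\<^sub>r A) *\<^sub>v X k"
      by (rule mat_mult_append[OF Dsc Ac X, symmetric])
    also have "\<dots> = ((Ds @\<^sub>r A) * S) *\<^sub>v (\<beta> k @\<^sub>v g (\<beta> k))"
      unfolding X_def by (rule assoc_mult_mat_vec[OF Dhc Sc bg, symmetric])
    also have "\<dots> = \<beta> k @\<^sub>v g (\<beta> k)" unfolding DhS using bg by simp
    finally have "(Ds *\<^sub>v X k) @\<^sub>v (A *\<^sub>v X k) = \<beta> k @\<^sub>v g (\<beta> k)" .
    moreover have "Ds *\<^sub>v X k \<in> carrier_vec ?d" using Dsc X[of k] by auto
    ultimately show "Ds *\<^sub>v X k = \<beta> k" "A *\<^sub>v X k = g (\<beta> k)"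
      using append_vec_eq[OF _ \<beta>c[of k]] by blast+
  qed
  have "is_local_min ?N f a" if acc: "is_accumulation_point ?N X a" for a
  proof -
    have a: "a \<in> carrier_vec ?N" using acc by (simp add: is_accumulation_point_def)
    \<comment> \<open>The lower coordinates of \<open>X k\<close> are the affine function \<open>g\<close> of the upper ones. As an affine
      equation in \<open>X k\<close>, this reads \<open>?E X k = H1 y\<close> and survives in the limit.\<close>
    let ?E = "A + H2 * Ds"
    have Ec: "?E \<in> carrier_mat ?k ?N" using Ac H2c Dsc by auto
    have E_mult: "?E *\<^sub>v \<alpha> = A *\<^sub>v \<alpha> + H2 *\<^sub>v (Ds *\<^sub>v \<alpha>)" if "\<alpha> \<in> carrier_vec ?N" for \<alpha>
      using that Ac H2c Dsc
      by (simp add: add_mult_distrib_mat_vec[of _ ?k ?N] assoc_mult_mat_vec[of _ ?k ?d _ ?N])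
    have H1y: "H1 *\<^sub>v y \<in> carrier_vec ?k" using H1c yc by auto
    have "?E *\<^sub>v X k = H1 *\<^sub>v y" for k
    proof -
      have "?E *\<^sub>v X k = g (\<beta> k) + H2 *\<^sub>v \<beta> k" by (simp add: E_mult[OF X] X_coords)
      also have "\<dots> = H1 *\<^sub>v y" using H1c H2c by (intro eq_vecI) (auto simp: g)
      finally show ?thesis .
    qed
    then have Ea: "?E *\<^sub>v a = H1 *\<^sub>v y"
      using is_accumulation_point_mult_mat_vec[OF Ec X acc] is_accumulation_point_const[OF H1y] by simp
    have "A *\<^sub>v a = (A *\<^sub>v a + H2 *\<^sub>v (Ds *\<^sub>v a)) - H2 *\<^sub>v (Ds *\<^sub>v a)"
      using Ac H2c by (intro eq_vecI) auto
    then have ga: "A *\<^sub>v a = g (Ds *\<^sub>v a)" by (simp only: E_mult[OF a, symmetric] Ea g)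
    have "is_accumulation_point ?d \<beta> (Ds *\<^sub>v a)"
      using is_accumulation_point_mult_mat_vec[OF Dsc X acc] by (simp add: X_coords)
    then show ?thesis
      by (rule is_local_min_transfer[OF Dsc a local_min_F F_le_f F_eq_f[OF a ga]])
  qed
  then show ?thesis using local_min_F unfolding X_def f_def by blast
qed

end
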